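(* Suppose there exist a continuously differentiable function $V:\mathbb{R}^{2n+q}\to\mathbb{R}$, positive reals $k,c_1,c_2,c_3$, and a neighborhood $\mathcal{U}\subset\mathbb{R}^{2n}$ of $0$ such that $c_1|x|_{\mathcal{A}}^k\le V(x)\le c_2|x|_{\mathcal{A}}^k$ for all $x\in\mathcal{C}$; $\langle\nabla V(x),f(x)\rangle\le-c_3V(x)$ for all $x\in\mathcal{U}\times\mathcal{T}$; and $V(g)-V(x)\le0$ for all $x\in\mathcal{D}$, $g\in G(x)$. Then the set $\mathcal{A}$ is exponentially stable for $\mathcal{H}_{cl}$. Moreover, the basin of attraction of $\mathcal{A}$ contains every sublevel set $\{x\in\mathcal{C}:V(x)\le c\}$ of the restriction of $V$ to $\mathcal{C}$ that is included in $\mathcal{U}\times\mathcal{T}$.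
   Context: Setting: integers $n,m\ge1$, $1\le q\le n$, $n_1,\dots,n_q\ge1$ with $\sum n_i=n$; $\mathcal{N}=\{1,\dots,q\}$; $A\in\mathbb{R}^{n\times n}$, $B\in\mathbb{R}^{n\times m}$, $K\in\mathbb{R}^{m\times n}$, $\bar u\in\mathbb{R}^m$ with $\bar u_i>0$; positive reals $T_1^{(i)}\le T_2^{(i)}$. $\mathfrak{sat}_{\bar u}(v)=(\operatorname{sat}_1(v_1),\dots,\operatorname{sat}_m(v_m))$, $\operatorname{sat}_i(s)=\min(|s|,\bar u_i)\operatorname{sign}(s)$, $\mathfrak{dz}_{\bar u}(y)=\mathfrak{sat}_{\bar u}(y)-y$; $A_{cl}=\begin{bmatrix}A+BK&-BK\\0&A\end{bmatrix}$, $B_{cl}=\begin{bmatrix}B\\0\end{bmatrix}$, $K_{cl}=[K\ \ -K]$. State $x=(x_p,\tilde\eta,\tau)\in\mathbb{R}^n\times\mathbb{R}^n\times\mathbb{R}^q$, $\bar x=(x_p,\tilde\eta)$, $\tilde\eta=(\tilde\eta^{(1)},\dots,\tilde\eta^{(q)})$, $\tilde\eta^{(i)}\in\mathbb{R}^{n_i}$; $\mathcal{T}=\prod_i[0,T_2^{(i)}]$. $\mathcal{H}_{cl}$: $\dot x=f(x)$ on $\mathcal{C}=\mathbb{R}^{2n}\times\mathcal{T}$ with $f(x)=(A_{cl}\bar x+B_{cl}\mathfrak{dz}_{\bar u}(K_{cl}\bar x),-\mathbf{1}_q)$; $x^+\in G(x)$ on $\mathcal{D}=\mathbb{R}^{2n}\times\bigcup_i\mathcal{D}_i$,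 $\mathcal{D}_i=\{\tau\in\mathcal{T}:\tau_i=0\}$, $G(x)=\bigcup_{i:\tau\in\mathcal{D}_i}\{x_p\}\times\{h_i(\tilde\eta)\}\times\widehat{\mathcal{G}}_i(\tau)$, where $h_i(\tilde\eta)$ replaces the block $\tilde\eta^{(i)}$ by $0$ and keeps the others, and $\widehat{\mathcal{G}}_i(\tau)=\{\chi\in\mathbb{R}^q:\chi_i\in[T_1^{(i)},T_2^{(i)}],\chi_k=\tau_k\ \forall k\ne i\}$. Solutions in the sense of Goebel–Sanfelice–Teel. $\mathcal{A}=\{0\}\times\mathcal{T}\subset\mathbb{R}^{2n}\times\mathbb{R}^q$, $|x|_{\mathcal{A}}$ distance to $\mathcal{A}$. $\mathcal{A}$ is exponentially stable if there exist $\kappa,\lambda,\mu>0$ such that every maximal solution $\phi$ with $|\phi(0,0)|_{\mathcal{A}}\le\mu$ is complete and $|\phi(t,j)|_{\mathcal{A}}\le\kappa e^{-\lambda(t+j)}|\phi(0,0)|_{\mathcal{A}}$ for all $(t,j)\in\operatorname{dom}\phi$; the basin of attraction is the set of points from which every maximal solution is complete and converges to $\mathcal{A}$. *)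

theory Defs
  imports "HOL-Analysis.Analysis"
begin

section \<open>Hybrid systems in the sense of Goebel--Sanfelice--Teel\<close>

definition compact_htd :: "(real \<times> nat) set \<Rightarrow> bool" where
  "compact_htd E \<longleftrightarrow> (\<exists>(J::nat) (ts::nat \<Rightarrow> real). ts 0 = 0 \<and> (\<forall>j\<le>J. ts j \<le> ts (Suc j)) \<and>
      E = (\<Union>j\<in>{0..J}. {ts j .. ts (Suc j)} \<times> {j}))"

definition htd :: "(real \<times> nat) set \<Rightarrow> bool" where
  "htd E \<longleftrightarrow> (0, 0) \<in> E \<and> E \<subseteq> {0..} \<times> UNIV \<and>
      (\<forall>T J. (T, J) \<in> E \<longrightarrow> compact_htd (E \<inter> ({0..T} \<times> {0..J})))"

definition tint :: "(real \<times> nat) set \<Rightarrow> nat \<Rightarrow> real set" where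
  "tint E j = {t. (t, j) \<in> E}"

definition abs_cont_on :: "real set \<Rightarrow> (real \<Rightarrow> 'a::real_normed_vector) \<Rightarrow> bool" where
  "abs_cont_on S g \<longleftrightarrow> (\<forall>\<epsilon>>0. \<exists>\<delta>>0. \<forall>(N::nat) (a::nat \<Rightarrow> real) (b::nat \<Rightarrow> real).
      (\<forall>k<N. a k \<le> b k \<and> a k \<in> S \<and> b k \<in> S) \<and> (\<forall>k. Suc k < N \<longrightarrow> b k \<le> a (Suc k)) \<and>
      (\<Sum>k<N. b k - a k) < \<delta> \<longrightarrow> (\<Sum>k<N. norm (g (b k) - g (a k))) < \<epsilon>)"

definition loc_abs_cont_on :: "real set \<Rightarrow> (real \<Rightarrow> 'a::real_normed_vector) \<Rightarrow> bool" where
  "loc_abs_cont_on I g \<longleftrightarrow> (\<forall>a b. a \<in> I \<longrightarrow> b \<in> I \<longrightarrow> abs_cont_on {a..b} g)"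

definition hybrid_arc :: "(real \<times> nat) set \<Rightarrow> (real \<times> nat \<Rightarrow> 'a::real_normed_vector) \<Rightarrow> bool" where
  "hybrid_arc E \<phi> \<longleftrightarrow> htd E \<and> (\<forall>j. loc_abs_cont_on (tint E j) (\<lambda>t. \<phi> (t, j)))"

definition is_solution ::
  "'a set \<Rightarrow> ('a \<Rightarrow> 'a) \<Rightarrow> 'a set \<Rightarrow> ('a \<Rightarrow> 'a set) \<Rightarrow>
   (real \<times> nat) set \<Rightarrow> (real \<times> nat \<Rightarrow> 'a::real_normed_vector) \<Rightarrow> bool" where
  "is_solution C f D G E \<phi> \<longleftrightarrow>
     hybrid_arc E \<phi> \<and>
     \<phi> (0, 0) \<in> closure C \<union> D \<and>
     (\<forall>j. interior (tint E j) \<noteq> {} \<longrightarrow>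
        (\<forall>t\<in>interior (tint E j). \<phi> (t, j) \<in> C) \<and>
        (AE t in lebesgue. t \<in> tint E j \<longrightarrow>
           ((\<lambda>s. \<phi> (s, j)) has_vector_derivative f (\<phi> (t, j))) (at t within tint E j))) \<and>
     (\<forall>t j. (t, j) \<in> E \<longrightarrow> (t, Suc j) \<in> E \<longrightarrow> \<phi> (t, j) \<in> D \<and> \<phi> (t, Suc j) \<in> G (\<phi> (t, j)))"

definition maximal_solution ::
  "'a set \<Rightarrow> ('a \<Rightarrow> 'a) \<Rightarrow> 'a set \<Rightarrow> ('a \<Rightarrow> 'a set) \<Rightarrow>
   (real \<times> nat) set \<Rightarrow> (real \<times> nat \<Rightarrow> 'a::real_normed_vector) \<Rightarrow> bool" where
  "maximal_solution C f D G E \<phi> \<longleftrightarrow> is_solution C f D G E \<phi> \<and>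
     \<not> (\<exists>E' \<phi>'. is_solution C f D G E' \<phi>' \<and> E \<subset> E' \<and> (\<forall>p\<in>E. \<phi>' p = \<phi> p))"

definition complete_dom :: "(real \<times> nat) set \<Rightarrow> bool" where
  "complete_dom E \<longleftrightarrow> (\<forall>M. \<exists>(t, j)\<in>E. t + real j \<ge> M)"

definition exp_stable ::
  "'a set \<Rightarrow> ('a \<Rightarrow> 'a) \<Rightarrow> 'a set \<Rightarrow> ('a \<Rightarrow> 'a set) \<Rightarrow> 'a::real_normed_vector set \<Rightarrow> bool" where
  "exp_stable C f D G \<A> \<longleftrightarrow> (\<exists>\<kappa> lam \<mu>. \<kappa> > 0 \<and> lam > 0 \<and> \<mu> > 0 \<and>
     (\<forall>E \<phi>. maximal_solution C f D G E \<phi> \<and> infdist (\<phi> (0, 0)) \<A> \<le> \<mu> \<longrightarrow>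
        complete_dom E \<and>
        (\<forall>t j. (t, j) \<in> E \<longrightarrow>
           infdist (\<phi> (t, j)) \<A> \<le> \<kappa> * exp (- lam * (t + real j)) * infdist (\<phi> (0, 0)) \<A>)))"

definition basin ::
  "'a set \<Rightarrow> ('a \<Rightarrow> 'a) \<Rightarrow> 'a set \<Rightarrow> ('a \<Rightarrow> 'a set) \<Rightarrow> 'a::real_normed_vector set \<Rightarrow> 'a set" where
  "basin C f D G \<A> = {\<xi>. \<forall>E \<phi>. maximal_solution C f D G E \<phi> \<and> \<phi> (0, 0) = \<xi> \<longrightarrow>
      complete_dom E \<and>
      (\<forall>\<epsilon>>0. \<exists>M. \<forall>t j. (t, j) \<in> E \<and> t + real j \<ge> M \<longrightarrow> infdist (\<phi> (t, j)) \<A> < \<epsilon>)}"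

text \<open>State x = ((x_p, eta), tau) with x_p, eta in R^n and tau in R^q.\<close>

definition sat1 :: "real \<Rightarrow> real \<Rightarrow> real" where
  "sat1 u s = min \<bar>s\<bar> u * sgn s"

definition satv :: "real^'m \<Rightarrow> real^'m \<Rightarrow> real^'m" where
  "satv ub v = (\<chi> i. sat1 (ub $ i) (v $ i))"

definition dzv :: "real^'m \<Rightarrow> real^'m \<Rightarrow> real^'m" where
  "dzv ub y = satv ub y - y"

text \<open>Block matrices A_cl, B_cl, K_cl, written as their actions.\<close>
definition Acl :: "real^'n^'n \<Rightarrow> real^'m^'n \<Rightarrow> real^'n^'m \<Rightarrow> (real^'n) \<times> (real^'n) \<Rightarrow> (real^'n) \<times> (real^'n)" where
  "Acl A B K xb = ((A + B ** K) *v fst xb - (B ** K) *v snd xb, A *v snd xb)"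

definition Bcl :: "real^'m^'n \<Rightarrow> real^'m \<Rightarrow> (real^'n) \<times> (real^'n)" where
  "Bcl B u = (B *v u, 0)"

definition Kcl :: "real^'n^'m \<Rightarrow> (real^'n) \<times> (real^'n) \<Rightarrow> real^'m" where
  "Kcl K xb = K *v fst xb - K *v snd xb"

definition Tset :: "real^'q \<Rightarrow> (real^'q) set" where
  "Tset T2 = {\<tau>. \<forall>i. 0 \<le> \<tau> $ i \<and> \<tau> $ i \<le> T2 $ i}"

definition Ccl :: "real^'q \<Rightarrow> (((real^'n) \<times> (real^'n)) \<times> (real^'q)) set" where
  "Ccl T2 = UNIV \<times> Tset T2"

definition fcl :: "real^'n^'n \<Rightarrow> real^'m^'n \<Rightarrow> real^'n^'m \<Rightarrow> real^'m \<Rightarrow>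
    ((real^'n) \<times> (real^'n)) \<times> (real^'q) \<Rightarrow> ((real^'n) \<times> (real^'n)) \<times> (real^'q)" where
  "fcl A B K ub x = (Acl A B K (fst x) + Bcl B (dzv ub (Kcl K (fst x))), (\<chi> i. - 1))"

definition Dset :: "real^'q \<Rightarrow> 'q \<Rightarrow> (real^'q) set" where
  "Dset T2 i = {\<tau> \<in> Tset T2. \<tau> $ i = 0}"

definition Dcl :: "real^'q \<Rightarrow> (((real^'n) \<times> (real^'n)) \<times> (real^'q)) set" where
  "Dcl T2 = UNIV \<times> (\<Union>i. Dset T2 i)"

text \<open>blk k = index of the block of eta containing coordinate k; h_i resets block i to zero.\<close>
definition hreset :: "('n \<Rightarrow> 'q) \<Rightarrow> 'q \<Rightarrow> real^'n \<Rightarrow> real^'n" where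
  "hreset blk i \<eta> = (\<chi> k. if blk k = i then 0 else \<eta> $ k)"

definition Ghat :: "real^'q \<Rightarrow> real^'q \<Rightarrow> 'q \<Rightarrow> real^'q \<Rightarrow> (real^'q) set" where
  "Ghat T1 T2 i \<tau> = {w. T1 $ i \<le> w $ i \<and> w $ i \<le> T2 $ i \<and> (\<forall>k. k \<noteq> i \<longrightarrow> w $ k = \<tau> $ k)}"

definition Gcl :: "('n \<Rightarrow> 'q) \<Rightarrow> real^'q \<Rightarrow> real^'q \<Rightarrow>
    ((real^'n) \<times> (real^'n)) \<times> (real^'q) \<Rightarrow> (((real^'n) \<times> (real^'n)) \<times> (real^'q)) set" where
  "Gcl blk T1 T2 x = (\<Union>i\<in>{i. snd x \<in> Dset T2 i}.
      ({fst (fst x)} \<times> {hreset blk i (snd (fst x))}) \<times> Ghat T1 T2 i (snd x))"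

definition Acl_set :: "real^'q \<Rightarrow> (((real^'n) \<times> (real^'n)) \<times> (real^'q)) set" where
  "Acl_set T2 = {0} \<times> Tset T2"

end

theory Submission
  imports Defs
begin

text \<open>
  Along a flow contained in a sublevel set, \<open>exp (c3 * t) * V\<close> is absolutely continuous with
  nonpositive derivative almost everywhere, and \<open>V\<close> does not increase at jumps; hence \<open>V\<close> decays like
  \<open>exp (- c3 * t)\<close>. Decay in \<open>t + j\<close> follows from a dwell-time bound: \<open>\<Sum>i. \<tau>\<^sub>i / T1\<^sub>i\<close> decreases at a
  constant rate during flows and grows by at least one at every jump, so \<open>j\<close> is bounded by an affine
  function of \<open>t\<close>. A maximal solution that stays in a bounded set is complete, since otherwise it could
  be prolonged by a jump (some timer is zero), by a flow (all timers are positive and the vector field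
  is Lipschitz), or by its limit at an open right end.
\<close>

section \<open>Absolutely continuous curves\<close>

text \<open>Three obstacles shape the proof. Flows are only absolutely continuous, so estimates
  along them go through one monotonicity principle for C1 functions of time and state,
  \<open>flow_on_nonincreasing\<close>, applied to \<open>exp (c3 * t) * V\<close>, to
  \<open>V\<close> and to linear functionals. A sublevel set may touch the boundary of
  \<open>U\<close>, beyond which the differential inequality is unknown; a flow is therefore first
  shown unable to leave the set, using only the sign of the derivative near the set, and decay comes
  afterwards. Prolonging a solution needs a linearly ordered domain, and this rests on the timers: a
  zero timer would turn negative, so no flow starts in the jump set. The constants come from
  \<open>j \<le> P + R * t\<close> with \<open>P = (\<Sum>i\<in>UNIV. T2 $ i / T1 $ i)\<close> and
  \<open>R = (\<Sum>i\<in>UNIV. 1 / T1 $ i)\<close>. Hence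
  \<open>t + j \<le> P + (1 + R) * t\<close>; the rate \<open>c3 / k\<close> of the norm in
  \<open>t\<close> becomes \<open>c3 / (k * (1 + R))\<close> in \<open>t + j\<close>, and the offset
  \<open>P\<close> becomes an exponential factor in the overshoot.\<close>

lemma abs_cont_onE:
  assumes "abs_cont_on S g" "e > 0"
  obtains d where "d > 0" "\<And>(N::nat) a b. (\<And>k. k < N \<Longrightarrow> a k \<le> b k \<and> a k \<in> S \<and> b k \<in> S) \<Longrightarrow>
      (\<And>k. Suc k < N \<Longrightarrow> b k \<le> a (Suc k)) \<Longrightarrow> (\<Sum>k<N. b k - a k) < d \<Longrightarrow>
      (\<Sum>k<N. norm (g (b k) - g (a k))) < e"
proof -
  from assms(1)[unfolded abs_cont_on_def, THEN spec, THEN mp, OF assms(2)]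
  obtain d where d: "d > 0" and D: "\<forall>(N::nat) a b.
      (\<forall>k<N. a k \<le> b k \<and> a k \<in> S \<and> b k \<in> S) \<and> (\<forall>k. Suc k < N \<longrightarrow> b k \<le> a (Suc k)) \<and>
      (\<Sum>k<N. b k - a k) < d \<longrightarrow> (\<Sum>k<N. norm (g (b k) - g (a k))) < e"
    by (elim exE conjE)
  show ?thesis
    by (rule that[OF d], rule D[THEN spec, THEN spec, THEN spec, THEN mp]) simp
qed

text \<open>Allowing both the increment of \<open>g\<close> and the interval length on the right
  lets one estimate serve Lipschitz maps (\<open>g\<close> constant) and C1 functions of time and
  state along a curve. Each of the two contributions is held below
  \<open>e / (2 * M)\<close>.\<close>

lemma abs_cont_on_dominated:
  assumes g: "abs_cont_on S g" and M: "M > 0"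
    and dom: "\<And>u v. u \<in> S \<Longrightarrow> v \<in> S \<Longrightarrow> u \<le> v \<Longrightarrow> norm (h v - h u) \<le> M * (norm (g v - g u) + (v - u))"
  shows "abs_cont_on S h"
  unfolding abs_cont_on_def
proof (intro allI impI)
  fix e :: real assume "e > 0"
  then have e: "e / (2 * M) > 0" using M by simp
  from abs_cont_onE[OF g this] obtain d where d: "d > 0" and D: "\<And>(N::nat) a b.
      (\<And>k. k < N \<Longrightarrow> a k \<le> b k \<and> a k \<in> S \<and> b k \<in> S) \<Longrightarrow> (\<And>k. Suc k < N \<Longrightarrow> b k \<le> a (Suc k)) \<Longrightarrow>
      (\<Sum>k<N. b k - a k) < d \<Longrightarrow> (\<Sum>k<N. norm (g (b k) - g (a k))) < e / (2 * M)"
    by blast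
  show "\<exists>\<delta>>0. \<forall>(N::nat) a b.
      (\<forall>k<N. a k \<le> b k \<and> a k \<in> S \<and> b k \<in> S) \<and> (\<forall>k. Suc k < N \<longrightarrow> b k \<le> a (Suc k)) \<and>
      (\<Sum>k<N. b k - a k) < \<delta> \<longrightarrow> (\<Sum>k<N. norm (h (b k) - h (a k))) < e"
  proof (intro exI[of _ "min d (e / (2 * M))"] conjI allI impI, goal_cases)
    case 1 then show ?case using d e by simp
  next
    case (2 N a b)
    have "(\<Sum>k<N. norm (h (b k) - h (a k))) \<le> (\<Sum>k<N. M * (norm (g (b k) - g (a k)) + (b k - a k)))"
      using 2 by (intro sum_mono dom) auto
    also have "\<dots> = M * ((\<Sum>k<N. norm (g (b k) - g (a k))) + (\<Sum>k<N. b k - a k))"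
      by (simp add: sum_distrib_left sum.distrib distrib_left)
    also have "\<dots> < M * (e / (2 * M) + e / (2 * M))"
      using 2 M by (intro mult_strict_left_mono add_strict_mono D) auto
    also have "\<dots> = e" using M by (simp add: field_simps)
    finally show ?case .
  qed
qed

lemma lipschitz_imp_abs_cont_on:
  assumes "M-lipschitz_on S h"
  shows "abs_cont_on S h"
proof (rule abs_cont_on_dominated[of S "\<lambda>_. 0::real" "M + 1"])
  show "abs_cont_on S (\<lambda>_. 0::real)"
    unfolding abs_cont_on_def by (auto intro: exI[of _ 1])
  show "M + 1 > 0" using lipschitz_on_nonneg[OF assms] by simp
  show "norm (h v - h u) \<le> (M + 1) * (norm (0 - 0::real) + (v - u))"
    if "u \<in> S" "v \<in> S" "u \<le> v" for u v
  proof -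
    have "norm (h v - h u) \<le> M * (v - u)"
      using lipschitz_onD[OF assms, of v u] that by (simp add: dist_norm)
    then show ?thesis using that by (simp add: algebra_simps)
  qed
qed

lemma abs_cont_on_subset:
  assumes "abs_cont_on S g" "R \<subseteq> S"
  shows "abs_cont_on R g"
  using assms(1) unfolding abs_cont_on_def
proof (elim all_forward imp_forward ex_forward conj_forward)
qed (use assms(2) in auto)

lemma abs_cont_on_imp_continuous_on:
  assumes "abs_cont_on S g"
  shows "continuous_on S g"
  unfolding continuous_on_iff
proof (intro ballI allI impI)
  fix x e :: real assume x: "x \<in> S" and "e > 0"
  from abs_cont_onE[OF assms this(2)] obtain d where d: "d > 0" and D: "\<And>(N::nat) a b.
      (\<And>k. k < N \<Longrightarrow> a k \<le> b k \<and> a k \<in> S \<and> b k \<in> S) \<Longrightarrow> (\<And>k. Suc k < N \<Longrightarrow> b k \<le> a (Suc k)) \<Longrightarrow>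
      (\<Sum>k<N. b k - a k) < d \<Longrightarrow> (\<Sum>k<N. norm (g (b k) - g (a k))) < e"
    by blast
  have "dist (g y) (g x) < e" if "y \<in> S" "dist y x < d" for y
    using D[of 1 "\<lambda>_. min x y" "\<lambda>_. max x y"] that x
    by (cases "x \<le> y") (auto simp: dist_norm norm_minus_commute)
  then show "\<exists>d>0. \<forall>y\<in>S. dist y x < d \<longrightarrow> dist (g y) (g x) < e" using d by blast
qed

text \<open>Cousin's argument: points of differentiability contribute at most \<open>e * length\<close>, while the
  intervals tagged in the exceptional null set lie in an open set of small measure, where absolute
  continuity controls the increments. The lists collect the latter intervals.\<close>

lemma abs_cont_on_nonincreasing:
  fixes g :: "real \<Rightarrow> real"
  assumes ac: "abs_cont_on {a..b} g" and ab: "a \<le> b"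
    and der: "AE t in lebesgue. t \<in> {a<..<b} \<longrightarrow> (\<exists>D\<le>0. (g has_real_derivative D) (at t))"
  shows "g b \<le> g a"
proof -
  have main: "g b - g a \<le> e * (b - a) + e" if e: "e > 0" for e
  proof -
    from abs_cont_onE[OF ac e] obtain d where d: "d > 0" and D: "\<And>(N::nat) p q.
      (\<And>k. k < N \<Longrightarrow> p k \<le> q k \<and> p k \<in> {a..b} \<and> q k \<in> {a..b}) \<Longrightarrow> (\<And>k. Suc k < N \<Longrightarrow> q k \<le> p (Suc k)) \<Longrightarrow>
      (\<Sum>k<N. q k - p k) < d \<Longrightarrow> (\<Sum>k<N. norm (g (q k) - g (p k))) < e"
    by blast
    obtain Z where Z: "\<And>t. t \<notin> Z \<Longrightarrow> t \<in> {a<..<b} \<longrightarrow> (\<exists>D\<le>0. (g has_real_derivative D) (at t))"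
      "Z \<in> null_sets lebesgue"
      using AE_E3[OF der] by (metis DiffI UNIV_I space_completion space_lborel space_borel)
    \<comment> \<open>\<open>der\<close> says nothing at \<open>a\<close> and \<open>b\<close>, so
      they join the exceptional set; every other point of the interval is then a point of
      differentiability.\<close>
    define Y where "Y = insert a (insert b Z)"
    have Y: "Y \<in> null_sets lebesgue"
      unfolding Y_def using Z(2) by (simp add: negligible_iff_null_sets[symmetric] negligible_insert)
    then obtain W where W: "open W" "Y \<subseteq> W" "W - Y \<in> lmeasurable" "emeasure lebesgue (W - Y) < ennreal d"
      using sets_lebesgue_outer_open[of Y d] d by (auto simp: null_sets_def)
    have Wd: "emeasure lebesgue W < ennreal d" 
    proof -
      have "W = (W - Y) \<union> Y" using W by auto
      then have "emeasure lebesgue W = emeasure lebesgue (W - Y)"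
        using Y W(3) by (metis emeasure_Un_null_set fmeasurableD)
      then show ?thesis using W by simp
    qed
    have Wl: "W \<in> lmeasurable" using Wd W(1)
      by (intro fmeasurableI) (auto simp: less_top[symmetric] intro: order.strict_trans)
    have Wm: "measure lebesgue W < d"
      using Wd Wl by (simp add: emeasure_eq_measure2 ennreal_less_iff)
    \<comment> \<open>The list carries the intervals on which only absolute continuity helps.
      Measuring \<open>W\<close> inside the open interval makes the length bound superadditive, so
      that neighbouring intervals are joined by appending their lists.\<close>
    define P where "P u v \<longleftrightarrow> (a \<le> u \<longrightarrow> v \<le> b \<longrightarrow> (\<exists>xs :: (real \<times> real) list.
       (\<forall>(p, q)\<in>set xs. u \<le> p \<and> p \<le> q \<and> q \<le> v) \<and> sorted_wrt (\<lambda>x y. snd x \<le> fst y) xs \<and>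
       (\<Sum>(p, q)\<leftarrow>xs. q - p) \<le> measure lebesgue (W \<inter> {u<..<v}) \<and>
       g v - g u \<le> e * (v - u) + (\<Sum>(p, q)\<leftarrow>xs. norm (g q - g p))))" for u v
    have "P a b"
      using ab
    proof (induction rule: Bolzano)
      case (trans u v w)
      show ?case unfolding P_def
      proof (intro impI)
        assume uw: "a \<le> u" "w \<le> b"
        obtain xs where xs: "\<forall>(p, q)\<in>set xs. u \<le> p \<and> p \<le> q \<and> q \<le> v" "sorted_wrt (\<lambda>x y. snd x \<le> fst y) xs"
           "(\<Sum>(p, q)\<leftarrow>xs. q - p) \<le> measure lebesgue (W \<inter> {u<..<v})"
           "g v - g u \<le> e * (v - u) + (\<Sum>(p, q)\<leftarrow>xs. norm (g q - g p))"
          using trans(1,3,4) uw unfolding P_def by auto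
        obtain ys where ys: "\<forall>(p, q)\<in>set ys. v \<le> p \<and> p \<le> q \<and> q \<le> w" "sorted_wrt (\<lambda>x y. snd x \<le> fst y) ys"
           "(\<Sum>(p, q)\<leftarrow>ys. q - p) \<le> measure lebesgue (W \<inter> {v<..<w})"
           "g w - g v \<le> e * (w - v) + (\<Sum>(p, q)\<leftarrow>ys. norm (g q - g p))"
          using trans(2,3,4) uw unfolding P_def by auto
        have lm: "W \<inter> {s<..<t} \<in> lmeasurable" for s t
          by (intro lmeasurable_open bounded_Int open_Int W) auto
        have "measure lebesgue (W \<inter> {u<..<v}) + measure lebesgue (W \<inter> {v<..<w})
            = measure lebesgue ((W \<inter> {u<..<v}) \<union> (W \<inter> {v<..<w}))"
          unfolding measure_Un2[OF lm lm] by (rule arg_cong2[where f = "(+)"]) (auto intro!: arg_cong[where f = "measure lebesgue"])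
        also have "\<dots> \<le> measure lebesgue (W \<inter> {u<..<w})"
          using lm trans(3,4) by (intro measure_mono_fmeasurable) (auto intro: fmeasurableD)
        finally have m: "measure lebesgue (W \<inter> {u<..<v}) + measure lebesgue (W \<inter> {v<..<w})
            \<le> measure lebesgue (W \<inter> {u<..<w})" .
        show "\<exists>xs. (\<forall>(p, q)\<in>set xs. u \<le> p \<and> p \<le> q \<and> q \<le> w) \<and> sorted_wrt (\<lambda>x y. snd x \<le> fst y) xs \<and>
           (\<Sum>(p, q)\<leftarrow>xs. q - p) \<le> measure lebesgue (W \<inter> {u<..<w}) \<and>
           g w - g u \<le> e * (w - u) + (\<Sum>(p, q)\<leftarrow>xs. norm (g q - g p))"
        proof (intro exI[of _ "xs @ ys"] conjI)
          show "\<forall>(p, q)\<in>set (xs @ ys). u \<le> p \<and> p \<le> q \<and> q \<le> w"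
            using xs(1) ys(1) trans(3,4) by fastforce
          show "sorted_wrt (\<lambda>x y. snd x \<le> fst y) (xs @ ys)"
            using xs(1,2) ys(1,2) by (fastforce simp: sorted_wrt_append)
          show "(\<Sum>(p, q)\<leftarrow>xs @ ys. q - p) \<le> measure lebesgue (W \<inter> {u<..<w})"
            using xs(3) ys(3) m by simp
          show "g w - g u \<le> e * (w - u) + (\<Sum>(p, q)\<leftarrow>xs @ ys. norm (g q - g p))"
            using xs(4) ys(4) by (simp add: algebra_simps)
        qed
      qed
    next
      case (local x)
      show ?case
      proof (cases "x \<in> Y")
        case True
        then obtain r where r: "r > 0" "ball x r \<subseteq> W" using W(1,2) open_contains_ball by blast
        have "P u v" if "u \<le> x" "x \<le> v" "v - u < r" for u v
        proof -
          have "{u<..<v} \<subseteq> W" using r that by (auto simp: subset_eq dist_real_def)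
          then have "W \<inter> {u<..<v} = {u<..<v}" by auto
          then show ?thesis unfolding P_def using that e
            by (intro impI exI[of _ "[(u, v)]"]) (auto intro: order_trans[OF abs_ge_self])
        qed
        then show ?thesis using r by blast
      next
        case False
        then have "x \<in> {a<..<b}" using local by (auto simp: Y_def)
        then obtain D where D: "D \<le> 0" "(g has_real_derivative D) (at x)"
          using False Z(1)[of x] by (auto simp: Y_def)
        then obtain r where r: "r > 0" "\<And>y. norm (y - x) < r \<Longrightarrow> norm (g y - g x - D * (y - x)) \<le> e * norm (y - x)"
          using e unfolding has_field_derivative_def has_derivative_at_alt by blast
        have "P u v" if "u \<le> x" "x \<le> v" "v - u < r" for u v
        proof -
          have "g v - g x \<le> D * (v - x) + e * (v - x)" "g x - g u \<le> D * (x - u) + e * (x - u)"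
            using r(2)[of v] r(2)[of u] that by (auto simp: abs_le_iff algebra_simps)
          moreover have "D * (v - x) \<le> 0" "D * (x - u) \<le> 0"
            using D that by (auto intro: mult_nonpos_nonneg)
          ultimately have "g v - g u \<le> e * (v - u)" by (simp add: algebra_simps)
          then show ?thesis unfolding P_def by (intro impI exI[of _ "[]"]) auto
        qed
        then show ?thesis using r by blast
      qed
    qed
    then obtain xs where xs: "\<forall>(p, q)\<in>set xs. a \<le> p \<and> p \<le> q \<and> q \<le> b" "sorted_wrt (\<lambda>x y. snd x \<le> fst y) xs"
           "(\<Sum>(p, q)\<leftarrow>xs. q - p) \<le> measure lebesgue (W \<inter> {a<..<b})"
           "g b - g a \<le> e * (b - a) + (\<Sum>(p, q)\<leftarrow>xs. norm (g q - g p))"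
      unfolding P_def by auto
    have "measure lebesgue (W \<inter> {a<..<b}) \<le> measure lebesgue W"
      using Wl W(1) by (intro measure_mono_fmeasurable) auto
    then have "(\<Sum>k<length xs. snd (xs ! k) - fst (xs ! k)) < d"
      using xs(3) Wm by (simp add: sum_list_sum_nth atLeast0LessThan case_prod_unfold)
    then have "(\<Sum>k<length xs. norm (g (snd (xs ! k)) - g (fst (xs ! k)))) < e"
    proof (intro D)
      fix k assume "k < length xs"
      then have "xs ! k \<in> set xs" by simp
      with xs(1) have "a \<le> fst (xs ! k) \<and> fst (xs ! k) \<le> snd (xs ! k) \<and> snd (xs ! k) \<le> b"
        by (auto simp: case_prod_unfold)
      then show "fst (xs ! k) \<le> snd (xs ! k) \<and> fst (xs ! k) \<in> {a..b} \<and> snd (xs ! k) \<in> {a..b}" by auto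
    next
      fix k assume "Suc k < length xs"
      then show "snd (xs ! k) \<le> fst (xs ! Suc k)" using xs(2) by (simp add: sorted_wrt_iff_nth_less)
    qed
    then show ?thesis using xs(4) by (simp add: sum_list_sum_nth atLeast0LessThan case_prod_unfold)
  qed
  have "g b - g a \<le> 0"
  proof (rule field_le_epsilon)
    fix e :: real assume "e > 0"
    define e' where "e' = e / (b - a + 1)"
    have "e' * (b - a) + e' = e' * (b - a + 1)" by (simp add: distrib_left)
    also have "\<dots> = e" using ab by (simp add: e'_def)
    finally show "g b - g a \<le> 0 + e"
      using main[of e'] ab \<open>e > 0\<close> by (simp add: e'_def)
  qed
  then show ?thesis by simp
qed

section \<open>C1 functions along flows\<close>

text \<open>The mean value inequality is applied on a ball containing \<open>S\<close>: it is
  convex, as \<open>S\<close> need not be, and compact, which bounds the gradient.\<close>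

lemma C1_bounded_lipschitz:
  fixes H :: "'a::euclidean_space \<Rightarrow> real"
  assumes "\<And>x. (H has_derivative (\<lambda>h. gH x \<bullet> h)) (at x)" "continuous_on UNIV gH" "bounded S"
  obtains M where "M > 0" "\<And>x y. x \<in> S \<Longrightarrow> y \<in> S \<Longrightarrow> \<bar>H x - H y\<bar> \<le> M * norm (x - y)"
proof -
  obtain r where r: "S \<subseteq> cball 0 r" using assms(3) by (auto simp: bounded_iff subset_eq)
  have "compact (gH ` cball 0 r)"
    by (intro compact_continuous_image continuous_on_subset[OF assms(2)]) auto
  then obtain M where M: "M > 0" "\<forall>z\<in>gH ` cball 0 r. norm z \<le> M"
    using compact_imp_bounded bounded_pos by metis
  have "norm (H x - H y) \<le> M * norm (x - y)" if "x \<in> S" "y \<in> S" for x y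
  proof (rule differentiable_bound[of "cball 0 r"])
    show "onorm (\<lambda>h. gH z \<bullet> h) \<le> M" if "z \<in> cball 0 r" for z
    proof (rule onorm_le)
      fix h
      have "norm (gH z \<bullet> h) \<le> norm (gH z) * norm h" by (simp add: Cauchy_Schwarz_ineq2)
      also have "\<dots> \<le> M * norm h" using M(2) that by (intro mult_right_mono) auto
      finally show "norm (gH z \<bullet> h) \<le> M * norm h" .
    qed
  qed (use assms(1) r that in \<open>auto intro: has_derivative_at_withinI\<close>)
  then show ?thesis using that M(1) by auto
qed

text \<open>One flow piece cut out of \<open>is_solution\<close>. Constraint and derivative concern
  the open interval only, where the derivative within the level is two-sided, so pieces can be
  shortened freely; continuity and closedness of \<open>C\<close> take care of the
  endpoints.\<close>

definition flow_on :: "'a set \<Rightarrow> ('a \<Rightarrow> 'a) \<Rightarrow> real \<Rightarrow> real \<Rightarrow> (real \<Rightarrow> 'a::real_normed_vector) \<Rightarrow> bool" where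
  "flow_on C f a b y \<longleftrightarrow> abs_cont_on {a..b} y \<and> (\<forall>t\<in>{a<..<b}. y t \<in> C) \<and>
     (AE t in lebesgue. t \<in> {a<..<b} \<longrightarrow> (y has_vector_derivative f (y t)) (at t))"

lemma flow_on_subinterval:
  assumes "flow_on C f a b y" "a \<le> c" "d \<le> b"
  shows "flow_on C f c d y"
  unfolding flow_on_def
proof (intro conjI)
  show "abs_cont_on {c..d} y"
    using assms by (auto simp: flow_on_def intro: abs_cont_on_subset[of "{a..b}"])
  show "\<forall>t\<in>{c<..<d}. y t \<in> C"
    using assms by (auto simp: flow_on_def)
  have "AE t in lebesgue. t \<in> {a<..<b} \<longrightarrow> (y has_vector_derivative f (y t)) (at t)"
    using assms by (simp add: flow_on_def)
  then show "AE t in lebesgue. t \<in> {c<..<d} \<longrightarrow> (y has_vector_derivative f (y t)) (at t)"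
    by eventually_elim (use assms in auto)
qed

lemma flow_on_endpoints:
  assumes "flow_on C f a b y" "closed C" "a < b" "t \<in> {a..b}"
  shows "y t \<in> C"
proof -
  have "y ` closure {a<..<b} \<subseteq> C"
    using assms unfolding flow_on_def
    by (intro image_closure_subset) (auto dest: abs_cont_on_imp_continuous_on)
  then show ?thesis using assms by auto
qed

text \<open>Letting \<open>H\<close> depend on time as well covers weighted quantities such as
  \<open>exp (c3 * t) * V x\<close>. On the compact graph of \<open>y\<close> the function
  \<open>H\<close> is Lipschitz, so \<open>H (t, y t)\<close> inherits absolute continuity; almost
  everywhere the chain rule gives a derivative whose sign is \<open>le\<close>.\<close>

lemma flow_on_nonincreasing:
  fixes y :: "real \<Rightarrow> 'a::euclidean_space" and H :: "real \<times> 'a \<Rightarrow> real"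
  assumes fl: "flow_on C f a b y" and ab: "a \<le> b"
    and H: "\<And>x. (H has_derivative (\<lambda>h. gH x \<bullet> h)) (at x)" and gH: "continuous_on UNIV gH"
    and le: "\<And>t. t \<in> {a<..<b} \<Longrightarrow> gH (t, y t) \<bullet> (1, f (y t)) \<le> 0"
  shows "H (b, y b) \<le> H (a, y a)"
proof (rule abs_cont_on_nonincreasing[OF _ ab, of "\<lambda>t. H (t, y t)"])
  have ac: "abs_cont_on {a..b} y" using fl by (simp add: flow_on_def)
  have "compact ((\<lambda>t. (t, y t)) ` {a..b})"
    by (intro compact_continuous_image continuous_intros abs_cont_on_imp_continuous_on[OF ac]) auto
  then obtain M where M: "M > 0" "\<And>p q. p \<in> (\<lambda>t. (t, y t)) ` {a..b} \<Longrightarrow> q \<in> (\<lambda>t. (t, y t)) ` {a..b}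
      \<Longrightarrow> \<bar>H p - H q\<bar> \<le> M * norm (p - q)"
    using C1_bounded_lipschitz[OF H gH compact_imp_bounded] by metis
  show "abs_cont_on {a..b} (\<lambda>t. H (t, y t))"
  proof (rule abs_cont_on_dominated[OF ac M(1)])
    fix u v assume uv: "u \<in> {a..b}" "v \<in> {a..b}" "u \<le> v"
    have "norm (H (v, y v) - H (u, y u)) \<le> M * norm ((v, y v) - (u, y u))"
      using M(2)[of "(v, y v)" "(u, y u)"] uv by auto
    also have "\<dots> \<le> M * (norm (y v - y u) + (v - u))"
      using M(1) uv norm_Pair_le[of "v - u" "y v - y u"] by (intro mult_left_mono) auto
    finally show "norm (H (v, y v) - H (u, y u)) \<le> M * (norm (y v - y u) + (v - u))" .
  qed
  have "\<exists>D\<le>0. ((\<lambda>t. H (t, y t)) has_real_derivative D) (at t)"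
    if "t \<in> {a<..<b}" "(y has_vector_derivative f (y t)) (at t)" for t
  proof -
    have "((\<lambda>t. (t, y t)) has_derivative (\<lambda>s. (s, s *\<^sub>R f (y t)))) (at t)"
      using that(2) unfolding has_vector_derivative_def by (intro derivative_eq_intros) auto
    from has_derivative_compose[OF this H]
    have "((\<lambda>t. H (t, y t)) has_derivative (\<lambda>s. gH (t, y t) \<bullet> (s, s *\<^sub>R f (y t)))) (at t)" .
    moreover have "(\<lambda>s. gH (t, y t) \<bullet> (s, s *\<^sub>R f (y t))) = (*) (gH (t, y t) \<bullet> (1, f (y t)))"
      by (auto simp: fun_eq_iff inner_prod_def algebra_simps)
    ultimately have "((\<lambda>t. H (t, y t)) has_real_derivative (gH (t, y t) \<bullet> (1, f (y t)))) (at t)"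
      unfolding has_field_derivative_def by simp
    then show ?thesis using le[OF that(1)] by blast
  qed
  moreover have "AE t in lebesgue. t \<in> {a<..<b} \<longrightarrow> (y has_vector_derivative f (y t)) (at t)"
    using fl by (simp add: flow_on_def)
  ultimately show "AE t in lebesgue. t \<in> {a<..<b} \<longrightarrow> (\<exists>D\<le>0. ((\<lambda>t. H (t, y t)) has_real_derivative D) (at t))"
    by (auto elim: eventually_mono)
qed

text \<open>Monotonicity of \<open>w \<bullet> x - M * t\<close>. In this form bounds on the field
  become bounds on increments, both of the whole state and of single or weighted timers.\<close>

lemma flow_on_linear_le:
  fixes y :: "real \<Rightarrow> 'a::euclidean_space"
  assumes "flow_on C f a b y" "a \<le> b" "\<And>t. t \<in> {a<..<b} \<Longrightarrow> w \<bullet> f (y t) \<le> M"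
  shows "w \<bullet> y b - w \<bullet> y a \<le> M * (b - a)"
proof -
  have "(\<lambda>p::real \<times> 'a. w \<bullet> snd p - M * fst p) (b, y b) \<le> (\<lambda>p::real \<times> 'a. w \<bullet> snd p - M * fst p) (a, y a)"
  proof (rule flow_on_nonincreasing[OF assms(1,2), where gH = "\<lambda>_. (- M, w)"])
    show "((\<lambda>p::real \<times> 'a. w \<bullet> snd p - M * fst p) has_derivative (\<lambda>h. (- M, w) \<bullet> h)) (at x)" for x
      by (auto intro!: derivative_eq_intros simp: inner_prod_def fun_eq_iff)
  qed (use assms(3) in auto)
  then show ?thesis by (simp add: algebra_simps)
qed

lemma flow_on_lipschitz:
  fixes y :: "real \<Rightarrow> 'a::euclidean_space"
  assumes fl: "flow_on C f a b y" and M: "\<And>t. t \<in> {a<..<b} \<Longrightarrow> norm (f (y t)) \<le> M" "M \<ge> 0"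
  shows "M-lipschitz_on {a..b} y"
proof (rule lipschitz_onI[OF _ M(2)])
  have *: "norm (y v - y u) \<le> M * (v - u)" if uv: "u \<in> {a..b}" "v \<in> {a..b}" "u \<le> v" for u v
  proof (cases "y v = y u")
    case False
    \<comment> \<open>Testing against the increment itself turns the scalar estimate into a norm
      estimate once \<open>norm w\<close> is cancelled.\<close>
    define w where "w = y v - y u"
    have "w \<bullet> y v - w \<bullet> y u \<le> (norm w * M) * (v - u)"
    proof (rule flow_on_linear_le[OF flow_on_subinterval[OF fl]])
      fix t assume t: "t \<in> {u<..<v}"
      have "w \<bullet> f (y t) \<le> norm w * norm (f (y t))" by (rule norm_cauchy_schwarz)
      also have "\<dots> \<le> norm w * M" using t uv by (intro mult_left_mono M) auto
      finally show "w \<bullet> f (y t) \<le> norm w * M" .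
    qed (use uv in auto)
    moreover have "w \<bullet> y v - w \<bullet> y u = norm w * norm w"
      by (simp add: w_def inner_diff_right[symmetric] power2_norm_eq_inner[symmetric] power2_eq_square)
    ultimately have "norm w * norm w \<le> norm w * (M * (v - u))" by (simp add: mult.assoc)
    then show ?thesis using False by (simp add: w_def)
  qed (use uv M(2) in auto)
  show "dist (y u) (y v) \<le> M * dist u v" if "u \<in> {a..b}" "v \<in> {a..b}" for u v
    using *[of u v] *[of v u] that
    by (cases "u \<le> v") (auto simp: dist_norm norm_minus_commute)
qed

section \<open>Hybrid time domains and prolongation of solutions\<close>

text \<open>\<open>compact_htd\<close> leaves the number of pieces and the last breakpoint open.
  Both are forced, because \<open>(T, J)\<close> and the end of the last piece belong to the same
  truncated set.\<close>

lemma htd_cut: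
  assumes E: "htd E" and TJ: "(T, J) \<in> E"
  shows "\<exists>ts. ts 0 = 0 \<and> (\<forall>j\<le>J. ts j \<le> ts (Suc j)) \<and> ts (Suc J) = T \<and>
    E \<inter> ({0..T} \<times> {0..J}) = (\<Union>j\<in>{0..J}. {ts j .. ts (Suc j)} \<times> {j})"
proof -
  have "compact_htd (E \<inter> ({0..T} \<times> {0..J}))" "0 \<le> T"
    using E TJ unfolding htd_def by auto
  then obtain J' and ts :: "nat \<Rightarrow> real" where ts: "ts 0 = 0" "\<forall>j\<le>J'. ts j \<le> ts (Suc j)"
      "E \<inter> ({0..T} \<times> {0..J}) = (\<Union>j\<in>{0..J'}. {ts j .. ts (Suc j)} \<times> {j})"
    unfolding compact_htd_def by auto
  have in1: "(T, J) \<in> (\<Union>j\<in>{0..J'}. {ts j .. ts (Suc j)} \<times> {j})"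
    using TJ \<open>0 \<le> T\<close> unfolding ts(3)[symmetric] by auto
  have in2: "(ts (Suc J'), J') \<in> E \<inter> ({0..T} \<times> {0..J})"
    unfolding ts(3) using ts(2) by auto
  have "J' = J" using in1 in2 by auto
  then have "ts (Suc J) = T" using in1 in2 by auto
  then show ?thesis using ts \<open>J' = J\<close> by blast
qed

text \<open>The breakpoint \<open>ts j\<close> of the cut at \<open>(t, j)\<close> is the start of
  the whole level: earlier points of the level lie in the same cut, later ones are larger anyway. It
  links a level to its predecessor and so drives the induction along solutions.\<close>

lemma htd_start:
  assumes E: "htd E" and tj: "(t, j) \<in> E"
  shows "\<exists>s\<le>t. {s..t} \<times> {j} \<subseteq> E \<and> (\<forall>u. (u, j) \<in> E \<longrightarrow> s \<le> u) \<and>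
    (j = 0 \<and> s = 0 \<or> (\<exists>i. j = Suc i \<and> (s, i) \<in> E))"
proof -
  from htd_cut[OF E tj] obtain ts where ts: "ts 0 = 0" "\<forall>i\<le>j. ts i \<le> ts (Suc i)" "ts (Suc j) = t"
    "E \<inter> ({0..t} \<times> {0..j}) = (\<Union>i\<in>{0..j}. {ts i .. ts (Suc i)} \<times> {i})"
    by (elim exE conjE)
  have mem: "(u, i) \<in> E" if "i \<le> j" "ts i \<le> u" "u \<le> ts (Suc i)" for u i
  proof -
    have "(u, i) \<in> (\<Union>i\<in>{0..j}. {ts i .. ts (Suc i)} \<times> {i})" using that by auto
    then show ?thesis unfolding ts(4)[symmetric] by auto
  qed
  show ?thesis
  proof (intro exI[of _ "ts j"] conjI allI impI)
    show le: "ts j \<le> t" using ts(2,3) by auto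
    show "{ts j..t} \<times> {j} \<subseteq> E" using mem[of j] ts(3) by auto
    show "ts j \<le> u" if "(u, j) \<in> E" for u
    proof (cases "u \<le> t")
      case True
      then have "(u, j) \<in> E \<inter> ({0..t} \<times> {0..j})" using that E by (auto simp: htd_def)
      then show ?thesis unfolding ts(4) by auto
    next
      case False then show ?thesis using le by simp
    qed
    show "j = 0 \<and> ts j = 0 \<or> (\<exists>i. j = Suc i \<and> (ts j, i) \<in> E)"
    proof (cases j)
      case 0 then show ?thesis using ts(1) by simp
    next
      case (Suc i) then show ?thesis using mem[of i "ts j"] ts(2) by simp
    qed
  qed
qed

lemma htd_interval:
  assumes "htd E" "(u, j) \<in> E" "(t, j) \<in> E"
  shows "{u..t} \<times> {j} \<subseteq> E"
proof -
  obtain s where "{s..t} \<times> {j} \<subseteq> E" "s \<le> u" using htd_start[OF assms(1,3)] assms(2) by blast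
  then show ?thesis by auto
qed

text \<open>Points on lower levels keep their cuts. For \<open>(T', J)\<close> the cut at
  \<open>(s, J)\<close> is reused with only its last breakpoint moved; \<open>ord\<close> prevents
  lower levels from contributing times between \<open>s\<close> and \<open>T'\<close>.\<close>

lemma htd_extend_flow:
  assumes E: "htd E" and ord: "\<And>t j t' j'. (t, j) \<in> E \<Longrightarrow> (t', j') \<in> E \<Longrightarrow> j < j' \<Longrightarrow> t \<le> t'"
    and sJ: "(s, J) \<in> E" and J: "\<And>t j. (t, j) \<in> E \<Longrightarrow> j \<le> J"
    and sT: "\<And>u. (u, J) \<in> E \<Longrightarrow> s \<le> u \<and> u \<le> T"
  shows "htd (E \<union> {s..T} \<times> {J})" (is "htd ?E'")
proof -
  have s0: "0 \<le> s" using E sJ by (auto simp: htd_def)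
  have "compact_htd (?E' \<inter> ({0..T'} \<times> {0..J'}))" if TJ: "(T', J') \<in> ?E'" for T' J'
  proof (cases "J' = J")
    case False
    then have "(T', J') \<in> E" "J' < J" using TJ J[of T' J'] by auto
    then have "?E' \<inter> ({0..T'} \<times> {0..J'}) = E \<inter> ({0..T'} \<times> {0..J'})" by auto
    then show ?thesis using E \<open>(T', J') \<in> E\<close> by (simp add: htd_def)
  next
    case True
    then have T': "s \<le> T'" "T' \<le> T" using TJ sT by auto
    from htd_cut[OF E sJ] obtain ts where ts: "ts 0 = 0" "\<forall>i\<le>J. ts i \<le> ts (Suc i)" "ts (Suc J) = s"
      "E \<inter> ({0..s} \<times> {0..J}) = (\<Union>i\<in>{0..J}. {ts i .. ts (Suc i)} \<times> {i})"
      by (elim exE conjE)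
    have mem: "(u, i) \<in> E \<and> 0 \<le> u \<and> u \<le> s \<longleftrightarrow> ts i \<le> u \<and> u \<le> ts (Suc i)" if "i \<le> J" for u i
    proof -
      have "(u, i) \<in> E \<inter> ({0..s} \<times> {0..J}) \<longleftrightarrow> (u, i) \<in> (\<Union>i\<in>{0..J}. {ts i .. ts (Suc i)} \<times> {i})"
        by (simp only: ts(4))
      then show ?thesis using that by auto
    qed
    \<comment> \<open>The cut is taken at the first time of level \<open>J\<close>, so its last
      piece is degenerate and can be stretched to \<open>{s..T'}\<close>.\<close>
    have tsJ: "ts J = s" using mem[of J "ts J"] sT[of "ts J"] ts(2)[rule_format, of J] ts(3) by auto
    define ts' where "ts' = ts(Suc J := T')"
    have "(u, i) \<in> ?E' \<inter> ({0..T'} \<times> {0..J}) \<longleftrightarrow> i \<le> J \<and> ts' i \<le> u \<and> u \<le> ts' (Suc i)" for u i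
    proof (cases "i < J")
      case True
      then show ?thesis using mem[of i u] ord[OF _ sJ, of u i] T' unfolding ts'_def by auto
    next
      case False
      then show ?thesis using sT[of u] T' s0 tsJ J[of u i] unfolding ts'_def by auto
    qed
    then have *: "(u, i) \<in> ?E' \<inter> ({0..T'} \<times> {0..J}) \<longleftrightarrow> (u, i) \<in> (\<Union>i\<in>{0..J}. {ts' i .. ts' (Suc i)} \<times> {i})" for u i
      unfolding UN_iff by simp
    have "?E' \<inter> ({0..T'} \<times> {0..J}) = (\<Union>i\<in>{0..J}. {ts' i .. ts' (Suc i)} \<times> {i})"
      by (rule set_eqI) (simp only: split_paired_all *)
    moreover have "ts' 0 = 0" using ts(1) by (simp add: ts'_def)
    moreover have "\<forall>j\<le>J. ts' j \<le> ts' (Suc j)" using ts(2) tsJ T' by (auto simp: ts'_def)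
    ultimately show ?thesis unfolding compact_htd_def True by blast
  qed
  then show ?thesis using E s0 unfolding htd_def by auto
qed

lemma htd_extend_jump:
  assumes E: "htd E" and TJ: "(T, J) \<in> E" and J: "\<And>t j. (t, j) \<in> E \<Longrightarrow> j \<le> J"
    and T: "\<And>u. (u, J) \<in> E \<Longrightarrow> u \<le> T"
  shows "htd (insert (T, Suc J) E)" (is "htd ?E'")
proof -
  have T0: "0 \<le> T" using E TJ by (auto simp: htd_def)
  have "compact_htd (?E' \<inter> ({0..T'} \<times> {0..J'}))" if TJ': "(T', J') \<in> ?E'" for T' J'
  proof (cases "J' = Suc J")
    case False
    then have "(T', J') \<in> E" "J' \<le> J" using TJ' J[of T' J'] by auto
    then have "?E' \<inter> ({0..T'} \<times> {0..J'}) = E \<inter> ({0..T'} \<times> {0..J'})" by auto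
    then show ?thesis using E \<open>(T', J') \<in> E\<close> by (simp add: htd_def)
  next
    case True
    then have T': "T' = T" using TJ' J[of T' J'] by auto
    from htd_cut[OF E TJ] obtain ts where ts: "ts 0 = 0" "\<forall>i\<le>J. ts i \<le> ts (Suc i)" "ts (Suc J) = T"
      "E \<inter> ({0..T} \<times> {0..J}) = (\<Union>i\<in>{0..J}. {ts i .. ts (Suc i)} \<times> {i})"
      by (elim exE conjE)
    define ts' where "ts' = ts(Suc (Suc J) := T)"
    have "?E' \<inter> ({0..T} \<times> {0..Suc J}) = (E \<inter> ({0..T} \<times> {0..J})) \<union> {T..T} \<times> {Suc J}"
      using T0 by (auto dest: J)
    also have "\<dots> = (\<Union>i\<in>{0..Suc J}. {ts' i .. ts' (Suc i)} \<times> {i})"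
      unfolding ts(4) using ts(3) by (auto simp: ts'_def atLeastAtMostSuc_conv)
    finally have "?E' \<inter> ({0..T} \<times> {0..Suc J}) = (\<Union>i\<in>{0..Suc J}. {ts' i .. ts' (Suc i)} \<times> {i})" .
    moreover have "ts' 0 = 0" using ts(1) by (simp add: ts'_def)
    moreover have "\<forall>j\<le>Suc J. ts' j \<le> ts' (Suc j)" using ts(2,3) by (auto simp: ts'_def le_Suc_eq)
    ultimately show ?thesis unfolding compact_htd_def True T' by blast
  qed
  then show ?thesis using E T0 unfolding htd_def by auto
qed

section \<open>Single levels of a solution, and induction along its domain\<close>

text \<open>Open intervals are used so that the result also reaches a last level that lacks its
  right end. Their points are interior to the level, which makes the derivative within the level an
  ordinary one.\<close>

lemma solution_flow_interior:
  assumes sol: "is_solution C f D G E \<phi>" and sub: "{a<..<b} \<times> {j} \<subseteq> E"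
  shows "\<forall>t\<in>{a<..<b}. \<phi> (t, j) \<in> C"
    and "AE t in lebesgue. t \<in> {a<..<b} \<longrightarrow> ((\<lambda>s. \<phi> (s, j)) has_vector_derivative f (\<phi> (t, j))) (at t)"
proof -
  have int: "{a<..<b} \<subseteq> interior (tint E j)"
    using sub by (intro interior_maximal) (auto simp: tint_def)
  show "\<forall>t\<in>{a<..<b}. \<phi> (t, j) \<in> C"
    using sol int unfolding is_solution_def by blast
  show "AE t in lebesgue. t \<in> {a<..<b} \<longrightarrow> ((\<lambda>s. \<phi> (s, j)) has_vector_derivative f (\<phi> (t, j))) (at t)"
  proof (cases "{a<..<b} = {}")
    case False
    then have "AE t in lebesgue. t \<in> tint E j \<longrightarrow>
        ((\<lambda>s. \<phi> (s, j)) has_vector_derivative f (\<phi> (t, j))) (at t within tint E j)"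
      using sol int unfolding is_solution_def by blast
    then show ?thesis
    proof eventually_elim
      case (elim t)
      show ?case
      proof
        assume "t \<in> {a<..<b}"
        then have "t \<in> interior (tint E j)" using int by blast
        then show "((\<lambda>s. \<phi> (s, j)) has_vector_derivative f (\<phi> (t, j))) (at t)"
          using elim interior_subset at_within_interior by (metis subsetD)
      qed
    qed
  next
    case True
    then show ?thesis by (auto simp: set_eq_iff)
  qed
qed

lemma solution_flow_on:
  assumes sol: "is_solution C f D G E \<phi>" and sub: "{a..b} \<times> {j} \<subseteq> E"
  shows "flow_on C f a b (\<lambda>t. \<phi> (t, j))"
proof (cases "a \<le> b")
  case True
  have "{a<..<b} \<times> {j} \<subseteq> E" using sub by auto
  moreover have "abs_cont_on {a..b} (\<lambda>t. \<phi> (t, j))"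
  proof -
    have "a \<in> tint E j" "b \<in> tint E j" using sub True by (auto simp: tint_def)
    then show ?thesis using sol unfolding is_solution_def hybrid_arc_def loc_abs_cont_on_def by blast
  qed
  ultimately show ?thesis using solution_flow_interior[OF sol] unfolding flow_on_def by blast
next
  case False
  then have "{a..b} = {}" "{a<..<b} = {}" by auto
  then show ?thesis
    by (simp add: flow_on_def lipschitz_imp_abs_cont_on[of 0] lipschitz_on_def)
qed

text \<open>Each level is crossed by one flow from its start, and consecutive levels are joined by a
  jump at a common time. Nondegenerate intervals in \<open>flow\<close> allow the value at the right
  end to be reached as a limit from inside.\<close>

lemma solution_induct [consumes 2, case_names init flow jump]:
  assumes sol: "is_solution C f D G E \<phi>" and tj: "(t, j) \<in> E"
    and init: "P 0 0"
    and flow: "\<And>a b j. a < b \<Longrightarrow> {a..b} \<times> {j} \<subseteq> E \<Longrightarrow> P a j \<Longrightarrow> P b j"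
    and jump: "\<And>t j. (t, j) \<in> E \<Longrightarrow> (t, Suc j) \<in> E \<Longrightarrow> P t j \<Longrightarrow> P t (Suc j)"
  shows "P t j"
proof -
  have E: "htd E" using sol by (simp add: is_solution_def hybrid_arc_def)
  show ?thesis using tj
  proof (induction j arbitrary: t)
    case 0
    obtain s where "s \<le> t" "{s..t} \<times> {0} \<subseteq> E" "s = 0" using htd_start[OF E 0] by blast
    then show ?case using flow[of 0 t 0] init by (cases "t = 0") auto
  next
    case (Suc j)
    obtain s where s: "s \<le> t" "{s..t} \<times> {Suc j} \<subseteq> E" "(s, j) \<in> E"
      using htd_start[OF E Suc.prems] by blast
    moreover have "(s, Suc j) \<in> E" using s by auto
    ultimately have "P s (Suc j)" using Suc.IH jump by blast
    then show ?case using flow[of s t "Suc j"] s by (cases "s = t") auto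
  qed
qed

lemma solution_in_flow_set:
  assumes sol: "is_solution C f D G E \<phi>" and "closed C" and "D \<subseteq> C"
    and "\<And>x. x \<in> D \<Longrightarrow> G x \<subseteq> C" and "(t, j) \<in> E"
  shows "\<phi> (t, j) \<in> C"
  using sol assms(5)
proof (induction rule: solution_induct)
  case init
  then show ?case using assms by (auto simp: is_solution_def)
next
  case (flow a b j)
  then show ?case using flow_on_endpoints[OF solution_flow_on[OF sol flow(2)] assms(2), of b] by simp
next
  case (jump t j)
  then show ?case using sol assms(4) unfolding is_solution_def by blast
qed

text \<open>The definition of a hybrid time domain only constrains the part of \<open>E\<close> below each of its
  points and so admits branching domains such as \<open>[0,2] \<times> {0} \<union> {(1,1)}\<close>. They carry no solution
  if flowing from the jump set is impossible.\<close>

lemma solution_domain_ordered: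
  assumes sol: "is_solution C f D G E \<phi>"
    and noflow: "\<And>y a b. a < b \<Longrightarrow> flow_on C f a b y \<Longrightarrow> y a \<notin> D"
    and tj: "(t, j) \<in> E" and tj': "(t', j') \<in> E" and "j < j'"
  shows "t \<le> t'"
proof (rule ccontr)
  assume "\<not> t \<le> t'"
  have E: "htd E" using sol by (simp add: is_solution_def hybrid_arc_def)
  from htd_cut[OF E tj'] obtain ts where "ts 0 = 0" and ts: "\<forall>i\<le>j'. ts i \<le> ts (Suc i)" and "ts (Suc j') = t'"
    and ts2: "E \<inter> ({0..t'} \<times> {0..j'}) = (\<Union>i\<in>{0..j'}. {ts i .. ts (Suc i)} \<times> {i})"
    by (elim exE conjE)
  \<comment> \<open>The time at which the domain leaves level \<open>j\<close> on its way to
    \<open>(t', j')\<close>. The jump there starts in \<open>D\<close>, yet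
    \<open>s \<le> t' < t\<close> means that the solution also flows on from the same point.\<close>
  define s where "s = ts (Suc j)"
  have "(s, j) \<in> (\<Union>i\<in>{0..j'}. {ts i .. ts (Suc i)} \<times> {i})" "(s, Suc j) \<in> (\<Union>i\<in>{0..j'}. {ts i .. ts (Suc i)} \<times> {i})"
    using ts[rule_format, of j] ts[rule_format, of "Suc j"] \<open>j < j'\<close> by (auto simp: s_def)
  then have s: "(s, j) \<in> E" "(s, Suc j) \<in> E" "s \<le> t'" unfolding ts2[symmetric] by auto
  then have "flow_on C f s t (\<lambda>u. \<phi> (u, j))"
    using solution_flow_on[OF sol] htd_interval[OF E s(1) tj] by blast
  then have "\<phi> (s, j) \<notin> D" using noflow[of s t] s(3) \<open>\<not> t \<le> t'\<close> by auto
  then show False using sol s unfolding is_solution_def by blast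
qed

section \<open>Prolongations and completeness\<close>

text \<open>Serves two prolongations: flowing on past an attained right end, and adding the limit at
  an open one. The curve \<open>y\<close> covers the whole enlarged last level, so its Lipschitz
  bound yields absolute continuity there at once.\<close>

lemma solution_extend_flow:
  assumes sol: "is_solution C f D G E \<phi>"
    and ord: "\<And>t j t' j'. (t, j) \<in> E \<Longrightarrow> (t', j') \<in> E \<Longrightarrow> j < j' \<Longrightarrow> t \<le> t'"
    and sJ: "(s, J) \<in> E" and J: "\<And>t j. (t, j) \<in> E \<Longrightarrow> j \<le> J"
    and sT: "\<And>u. (u, J) \<in> E \<Longrightarrow> s \<le> u \<and> u \<le> T"
    and y: "\<And>u. (u, J) \<in> E \<Longrightarrow> y u = \<phi> (u, J)" and lip: "M-lipschitz_on {s..T} y"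
    and yC: "\<And>t. t \<in> {s<..<T} \<Longrightarrow> y t \<in> C"
    and der: "AE t in lebesgue. t \<in> {s<..<T} \<longrightarrow> (y has_vector_derivative f (y t)) (at t)"
  shows "is_solution C f D G (E \<union> {s..T} \<times> {J}) (\<lambda>(t, j). if j = J then y t else \<phi> (t, j))"
    (is "is_solution C f D G ?E' ?\<phi>'")
proof -
  have E: "htd E" using sol by (simp add: is_solution_def hybrid_arc_def)
  have tJ: "tint ?E' J = {s..T}" using sT by (auto simp: tint_def)
  have tj: "tint ?E' j = tint E j" if "j \<noteq> J" for j using that by (auto simp: tint_def)
  have same: "?\<phi>' p = \<phi> p" if "p \<in> E" for p using that y by (auto split: prod.splits)
  have agree: "(\<lambda>t. ?\<phi>' (t, j)) = (if j = J then y else (\<lambda>t. \<phi> (t, j)))" for j by auto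
  show ?thesis unfolding is_solution_def
  proof (intro conjI allI impI)
    show "hybrid_arc ?E' ?\<phi>'" unfolding hybrid_arc_def
    proof (intro conjI allI)
      show "htd ?E'" by (rule htd_extend_flow[OF E ord sJ J sT])
      show "loc_abs_cont_on (tint ?E' j) (\<lambda>t. ?\<phi>' (t, j))" for j
      proof (cases "j = J")
        case True
        have "abs_cont_on {a..b} y" if "a \<in> {s..T}" "b \<in> {s..T}" for a b
          using lipschitz_imp_abs_cont_on[OF lipschitz_on_subset[OF lip]] that by auto
        then show ?thesis unfolding loc_abs_cont_on_def agree using tJ True by auto
      next
        case False
        then show ?thesis unfolding agree using tj[OF False] sol
          by (simp add: is_solution_def hybrid_arc_def)
      qed
    qed
    show "?\<phi>' (0, 0) \<in> closure C \<union> D"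
      using same[of "(0, 0)"] E sol by (simp add: htd_def is_solution_def)
    fix j assume ne: "interior (tint ?E' j) \<noteq> {}"
    show "\<forall>t\<in>interior (tint ?E' j). ?\<phi>' (t, j) \<in> C"
    proof (cases "j = J")
      case True then show ?thesis using tJ yC by auto
    next
      case False then show ?thesis using tj[OF False] sol ne by (auto simp: is_solution_def)
    qed
    show "AE t in lebesgue. t \<in> tint ?E' j \<longrightarrow>
       ((\<lambda>s. ?\<phi>' (s, j)) has_vector_derivative f (?\<phi>' (t, j))) (at t within tint ?E' j)"
    proof (cases "j = J")
      case True
      \<comment> \<open>\<open>der\<close> covers the open interval only; the two ends of the level
        are negligible.\<close>
      have "{s, T} \<in> null_sets lebesgue" by (simp add: negligible_iff_null_sets[symmetric])
      then have "AE t in lebesgue. t \<notin> {s, T}" by (rule AE_not_in)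
      with der show ?thesis
      proof eventually_elim
        case (elim t)
        then show ?case unfolding agree using True tJ
          by (auto intro: has_vector_derivative_at_within)
      qed
    next
      case False then show ?thesis unfolding agree using tj[OF False] sol ne by (simp add: is_solution_def)
    qed
  next
    fix t j assume t: "(t, j) \<in> ?E'" "(t, Suc j) \<in> ?E'"
    then have "Suc j \<le> J" using J by auto
    then have tE: "(t, j) \<in> E" using t by auto
    \<comment> \<open>Enlarging level \<open>J\<close> creates no new jump: a jump into it can only
      occur at its start \<open>s\<close>, which was already in the domain.\<close>
    have "(t, Suc j) \<in> E"
    proof (cases "Suc j = J")
      case True
      then have "t \<le> s" using ord[OF tE sJ] by simp
      moreover have "s \<le> t" using t True sT by auto
      ultimately show ?thesis using sJ True by simp
    next
      case False then show ?thesis using t by auto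
    qed
    then show "?\<phi>' (t, j) \<in> D" "?\<phi>' (t, Suc j) \<in> G (?\<phi>' (t, j))"
      unfolding same[OF tE] same[OF \<open>(t, Suc j) \<in> E\<close>] using sol tE unfolding is_solution_def by blast+
  qed
qed

text \<open>Level \<open>Suc J\<close> consists of one time, so its interior is empty and the only
  new condition is the jump at \<open>(T, J)\<close>.\<close>

lemma solution_extend_jump:
  assumes sol: "is_solution C f D G E \<phi>"
    and TJ: "(T, J) \<in> E" and J: "\<And>t j. (t, j) \<in> E \<Longrightarrow> j \<le> J"
    and T: "\<And>u. (u, J) \<in> E \<Longrightarrow> u \<le> T"
    and g: "\<phi> (T, J) \<in> D" "g \<in> G (\<phi> (T, J))"
  shows "is_solution C f D G (insert (T, Suc J) E) (\<phi>((T, Suc J) := g))"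
    (is "is_solution C f D G ?E' ?\<phi>'")
proof -
  have E: "htd E" using sol by (simp add: is_solution_def hybrid_arc_def)
  have tJ: "tint ?E' (Suc J) = {T}" using J by (fastforce simp: tint_def)
  have tj: "tint ?E' j = tint E j" if "j \<noteq> Suc J" for j using that by (auto simp: tint_def)
  have agree: "(\<lambda>t. ?\<phi>' (t, j)) = (\<lambda>t. \<phi> (t, j))" "?\<phi>' (t, j) = \<phi> (t, j)" if "j \<noteq> Suc J" for j t
    using that by auto
  show ?thesis unfolding is_solution_def
  proof (intro conjI allI impI)
    show "hybrid_arc ?E' ?\<phi>'" unfolding hybrid_arc_def
    proof (intro conjI allI)
      show "htd ?E'" by (rule htd_extend_jump[OF E TJ J T])
      show "loc_abs_cont_on (tint ?E' j) (\<lambda>t. ?\<phi>' (t, j))" for j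
      proof (cases "j = Suc J")
        case True
        have "0-lipschitz_on {T..T} (\<lambda>t. ?\<phi>' (t, j))" by (rule lipschitz_onI) auto
        then have "abs_cont_on {T..T} (\<lambda>t. ?\<phi>' (t, j))" by (rule lipschitz_imp_abs_cont_on)
        then show ?thesis unfolding loc_abs_cont_on_def True tJ by auto
      next
        case False
        then show ?thesis unfolding agree[OF False] tj[OF False] using sol
          by (simp add: is_solution_def hybrid_arc_def)
      qed
    qed
    show "?\<phi>' (0, 0) \<in> closure C \<union> D" using sol by (simp add: is_solution_def)
    fix j assume ne: "interior (tint ?E' j) \<noteq> {}"
    then have j: "j \<noteq> Suc J" using tJ by auto
    show "\<forall>t\<in>interior (tint ?E' j). ?\<phi>' (t, j) \<in> C"
      "AE t in lebesgue. t \<in> tint ?E' j \<longrightarrow>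
       ((\<lambda>s. ?\<phi>' (s, j)) has_vector_derivative f (?\<phi>' (t, j))) (at t within tint ?E' j)"
      using ne sol unfolding tj[OF j] agree[OF j] is_solution_def by blast+
  next
    fix t j assume t: "(t, j) \<in> ?E'" "(t, Suc j) \<in> ?E'"
    then have j: "j \<noteq> Suc J" using J by fastforce
    then have tE: "(t, j) \<in> E" using t by auto
    have "\<phi> (t, j) \<in> D \<and> ?\<phi>' (t, Suc j) \<in> G (\<phi> (t, j))"
    proof (cases "j = J")
      case True
      then have "t = T" using t J[of t "Suc J"] by auto
      then show ?thesis using g True by simp
    next
      case False
      then have "(t, Suc j) \<in> E" using t by auto
      then show ?thesis using sol tE False unfolding is_solution_def by auto
    qed
    then show "?\<phi>' (t, j) \<in> D" "?\<phi>' (t, Suc j) \<in> G (?\<phi>' (t, j))" unfolding agree(2)[OF j] by auto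
  qed
qed

text \<open>A uniform bound on the field gives one Lipschitz constant for a whole level even if the
  level is not closed; this later supplies the limit at an open right end.\<close>

lemma solution_lipschitz:
  fixes \<phi> :: "real \<times> nat \<Rightarrow> 'a::euclidean_space"
  assumes sol: "is_solution C f D G E \<phi>" and bnd: "\<And>p. p \<in> E \<Longrightarrow> norm (f (\<phi> p)) \<le> M"
  shows "M-lipschitz_on (tint E j) (\<lambda>t. \<phi> (t, j))"
proof (rule lipschitz_onI)
  have E: "htd E" using sol by (simp add: is_solution_def hybrid_arc_def)
  show M: "0 \<le> M" using order_trans[OF norm_ge_zero bnd[of "(0, 0)"]] E by (simp add: htd_def)
  have *: "dist (\<phi> (u, j)) (\<phi> (v, j)) \<le> M * dist u v" if uv: "(u, j) \<in> E" "(v, j) \<in> E" "u \<le> v" for u v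
  proof -
    have sub: "{u..v} \<times> {j} \<subseteq> E" using htd_interval[OF E uv(1,2)] .
    have "M-lipschitz_on {u..v} (\<lambda>t. \<phi> (t, j))"
      using sub by (intro flow_on_lipschitz[OF solution_flow_on[OF sol sub]] bnd M) auto
    then show ?thesis using uv by (auto dest: lipschitz_onD)
  qed
  show "dist (\<phi> (u, j)) (\<phi> (v, j)) \<le> M * dist u v" if "u \<in> tint E j" "v \<in> tint E j" for u v
    using *[of u v] *[of v u] that by (cases "u \<le> v") (auto simp: tint_def dist_commute)
qed

text \<open>Incompleteness bounds \<open>t + j\<close>, so there is a last level \<open>J\<close>
  with a start \<open>s\<close> and a finite supremum \<open>T\<close>. \<open>noflow\<close>
  excludes branching domains and thereby supplies the ordering that the prolongation by a flow
  needs.\<close>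

lemma maximal_solution_complete:
  fixes \<phi> :: "real \<times> nat \<Rightarrow> 'a::euclidean_space"
  assumes max: "maximal_solution C f D G E \<phi>"
    and noflow: "\<And>y a b. a < b \<Longrightarrow> flow_on C f a b y \<Longrightarrow> y a \<notin> D"
    and inC: "\<And>p. p \<in> E \<Longrightarrow> \<phi> p \<in> C" and bnd: "\<And>p. p \<in> E \<Longrightarrow> norm (f (\<phi> p)) \<le> M"
    and G: "\<And>x. x \<in> D \<Longrightarrow> G x \<noteq> {}"
    and ex: "\<And>x. x \<in> C - D \<Longrightarrow> \<exists>h>0. \<exists>L y. y 0 = x \<and> L-lipschitz_on {0..h} y \<and>
       (\<forall>t\<in>{0<..<h}. y t \<in> C \<and> (y has_vector_derivative f (y t)) (at t))"
  shows "complete_dom E"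
proof (rule ccontr)
  assume "\<not> complete_dom E"
  then obtain B where "\<not> (\<exists>(t, j)\<in>E. B \<le> t + real j)"
    unfolding complete_dom_def by blast
  then have B: "t + real j < B" if "(t, j) \<in> E" for t j using that by fastforce
  have sol: "is_solution C f D G E \<phi>" using max by (simp add: maximal_solution_def)
  have E: "htd E" using sol by (simp add: is_solution_def hybrid_arc_def)
  have pos: "0 \<le> t" if "(t, j) \<in> E" for t j using E that by (auto simp: htd_def)
  have ord: "t \<le> t'" if "(t, j) \<in> E" "(t', j') \<in> E" "j < j'" for t j t' j'
    using solution_domain_ordered[OF sol _ that] noflow by blast
  have no_ext: "E' \<subseteq> E" if "is_solution C f D G E' \<phi>'" "E \<subseteq> E'" "\<And>p. p \<in> E \<Longrightarrow> \<phi>' p = \<phi> p" for E' \<phi>'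
    using max that unfolding maximal_solution_def by blast
  have fin: "finite (snd ` E)"
  proof (rule finite_subset)
    show "snd ` E \<subseteq> {..nat \<lceil>B\<rceil>}"
    proof
      fix j assume "j \<in> snd ` E"
      then obtain t where "(t, j) \<in> E" by auto
      then have "real j < B" using B pos by fastforce
      then show "j \<in> {..nat \<lceil>B\<rceil>}" by simp linarith
    qed
  qed simp
  define J where "J = Max (snd ` E)"
  have J: "j \<le> J" if "(t, j) \<in> E" for t j
    unfolding J_def using that fin by (intro Max_ge) force+
  have "J \<in> snd ` E" unfolding J_def using fin E by (intro Max_in) (auto simp: htd_def)
  then obtain t0 where t0: "(t0, J) \<in> E" by auto
  obtain s where s: "(s, J) \<in> E" "\<And>u. (u, J) \<in> E \<Longrightarrow> s \<le> u"
  proof -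
    from htd_start[OF E t0] obtain s where "s \<le> t0" "{s..t0} \<times> {J} \<subseteq> E" "\<forall>u. (u, J) \<in> E \<longrightarrow> s \<le> u"
      by blast
    then show ?thesis by (intro that[of s]) auto
  qed
  have bdd: "bdd_above (tint E J)" using B by (intro bdd_aboveI[of _ B]) (fastforce simp: tint_def)
  define T where "T = Sup (tint E J)"
  have T: "u \<le> T" if "(u, J) \<in> E" for u
    unfolding T_def using that bdd by (intro cSup_upper) (auto simp: tint_def)
  have sT: "s \<le> u \<and> u \<le> T" if "(u, J) \<in> E" for u using s(2) T that by blast
  have below: "(u, J) \<in> E" if u: "s \<le> u" "u < T" for u
  proof -
    obtain v where "(v, J) \<in> E" "u < v"
      using u(2) s(1) unfolding T_def by (subst (asm) less_cSup_iff[OF _ bdd]) (auto simp: tint_def)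
    then show ?thesis using htd_interval[OF E s(1), of v] u by auto
  qed
  have lip: "M-lipschitz_on (tint E J) (\<lambda>t. \<phi> (t, J))" by (rule solution_lipschitz[OF sol bnd])
  have "{s<..<T} \<times> {J} \<subseteq> E" using below by auto
  note int = solution_flow_interior[OF sol this]
  show False
  proof (cases "(T, J) \<in> E")
    case True
    show False
    proof (cases "\<phi> (T, J) \<in> D")
      case D: True
      then obtain g where "g \<in> G (\<phi> (T, J))" using G by blast
      from no_ext[OF solution_extend_jump[OF sol True J T D this]]
      have "(T, Suc J) \<in> E" using J by fastforce
      then show False using J by fastforce
    next
      case False
      then obtain h L y where h: "h > 0" "y 0 = \<phi> (T, J)" "L-lipschitz_on {0..h} y"
        and y: "\<And>t. t \<in> {0<..<h} \<Longrightarrow> y t \<in> C \<and> (y has_vector_derivative f (y t)) (at t)"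
        using ex[of "\<phi> (T, J)"] inC[OF True] by blast
      define z where "z t = (if t \<le> T then \<phi> (t, J) else y (t - T))" for t
      have I: "tint E J = {s..T}" using htd_interval[OF E s(1) True] sT by (auto simp: tint_def)
      have "L-lipschitz_on {T..T + h} (\<lambda>t. y (t - T))"
      proof (rule lipschitz_onI)
        show "dist (y (u - T)) (y (v - T)) \<le> L * dist u v" if "u \<in> {T..T + h}" "v \<in> {T..T + h}" for u v
          using lipschitz_onD[OF h(3), of "u - T" "v - T"] that by (simp add: dist_norm)
      qed (rule lipschitz_on_nonneg[OF h(3)])
      then have zlip: "(max M L)-lipschitz_on {s..T + h} z"
        unfolding z_def using lip h(2) I by (intro lipschitz_on_concat_max) auto
      have zC: "z t \<in> C" if "t \<in> {s<..<T + h}" for t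
      proof (cases "t \<le> T")
        case True
        then have "t \<in> tint E J" unfolding I using that by simp
        then show ?thesis using inC[of "(t, J)"] True by (simp add: z_def tint_def)
      next
        case False
        then show ?thesis using y[of "t - T"] that by (simp add: z_def)
      qed
      have right: "(z has_vector_derivative f (z t)) (at t)" if "t \<in> {T<..<T + h}" for t
      proof -
        have "(y has_vector_derivative f (y (t - T))) (at (t - T))" using y[of "t - T"] that by simp
        moreover have "((\<lambda>u. u - T) has_vector_derivative 1) (at t)"
          unfolding has_real_derivative_iff_has_vector_derivative[symmetric]
          by (auto intro!: derivative_eq_intros)
        ultimately have "((\<lambda>u. y (u - T)) has_vector_derivative f (y (t - T))) (at t)"
          using vector_diff_chain_at[of "\<lambda>u. u - T" 1 t y "f (y (t - T))"] by (simp add: o_def)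
        then show ?thesis
          using that by (intro has_vector_derivative_transform_within_open[of "\<lambda>u. y (u - T)" _ _ "{T<..<T + h}" z])
            (auto simp: z_def)
      qed
      have left: "(z has_vector_derivative f (z t)) (at t)"
        if "t \<in> {s<..<T}" "((\<lambda>u. \<phi> (u, J)) has_vector_derivative f (\<phi> (t, J))) (at t)" for t
      proof (rule has_vector_derivative_transform_within_open[where S = "{s<..<T}"])
        show "((\<lambda>u. \<phi> (u, J)) has_vector_derivative f (z t)) (at t)" using that by (simp add: z_def)
      qed (use that in \<open>auto simp: z_def\<close>)
      \<comment> \<open>Differentiability of \<open>z\<close> at the junction \<open>T\<close> is
        not claimed; a single time is negligible.\<close>
      have "{T} \<in> null_sets lebesgue" by (simp add: negligible_iff_null_sets[symmetric])
      then have "AE t in lebesgue. t \<notin> {T}" by (rule AE_not_in)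
      with int(2) have zder: "AE t in lebesgue. t \<in> {s<..<T + h} \<longrightarrow> (z has_vector_derivative f (z t)) (at t)"
      proof eventually_elim
        case (elim t)
        then show ?case using left[of t] right[of t] by (cases "t < T") auto
      qed
      have "is_solution C f D G (E \<union> {s..T + h} \<times> {J}) (\<lambda>(t, j). if j = J then z t else \<phi> (t, j))"
        using sT h(1) by (intro solution_extend_flow[OF sol ord s(1) J _ _ zlip zC zder]) (force simp: z_def)+
      from no_ext[OF this] have "(T + h, J) \<in> E"
        using T h(1) sT[OF s(1)] by (force simp: z_def split: prod.splits)
      then show False using T h(1) by force
    qed
  next
    case False
    then have sT': "s < T" using sT[OF s(1)] s(1) by (cases "s = T") auto
    have "u \<noteq> T" if "(u, J) \<in> E" for u using that False by auto
    then have "(u, J) \<in> E \<longleftrightarrow> s \<le> u \<and> u < T" for u using below[of u] sT[of u] by fastforce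
    then have I: "tint E J = {s..<T}" by (simp add: tint_def set_eq_iff)
    \<comment> \<open>A Lipschitz map extends to the closure of its domain; the value of the
      extension at \<open>T\<close> is the missing limit.\<close>
    have "closure {s..<T} = {s..T}" using sT' by (rule closure_atLeastLessThan)
    with lipschitz_extend_closure[OF lip]
    obtain y where y: "M-lipschitz_on {s..T} y" "\<And>t. t \<in> {s..<T} \<Longrightarrow> y t = \<phi> (t, J)"
      unfolding I by metis
    have yder: "AE t in lebesgue. t \<in> {s<..<T} \<longrightarrow> (y has_vector_derivative f (y t)) (at t)"
      using int(2)
    proof eventually_elim
      case (elim t)
      show ?case
      proof
        assume t: "t \<in> {s<..<T}"
        show "(y has_vector_derivative f (y t)) (at t)"
        proof (rule has_vector_derivative_transform_within_open[where S = "{s<..<T}"])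
          show "((\<lambda>u. \<phi> (u, J)) has_vector_derivative f (y t)) (at t)" using elim t y(2) by simp
        qed (use t y(2) in auto)
      qed
    qed
    have yE: "y u = \<phi> (u, J)" if "(u, J) \<in> E" for u
    using y(2)[of u] that unfolding I[symmetric] by (simp add: tint_def)
    have "is_solution C f D G (E \<union> {s..T} \<times> {J}) (\<lambda>(t, j). if j = J then y t else \<phi> (t, j))"
      using int(1) y(2) by (intro solution_extend_flow[OF sol ord s(1) J sT yE y(1) _ yder]) auto
    from no_ext[OF this] have "(T, J) \<in> E" using sT' yE by (force split: prod.splits)
    then show False using False by simp
  qed
qed

section \<open>The closed-loop data\<close>

text \<open>Picard iteration as a contraction of the bounded continuous functions on the whole line.
  Since \<open>F\<close> is globally Lipschitz, the iterates need not be confined to a ball around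
  \<open>x0\<close>.\<close>

lemma lipschitz_ode_local_solution:
  fixes F :: "'a::euclidean_space \<Rightarrow> 'a"
  assumes L: "L-lipschitz_on UNIV F"
  obtains h z where "h > 0" "z 0 = x0"
    "\<And>t. t \<in> {0..h} \<Longrightarrow> (z has_vector_derivative F (z t)) (at t within {0..h})"
proof -
  have L0: "0 \<le> L" using lipschitz_on_nonneg[OF L] .
  \<comment> \<open>Makes the contraction factor \<open>L * h\<close> at most one half; the
    \<open>+ 1\<close> covers \<open>L = 0\<close>.\<close>
  define h where "h = 1 / (2 * (L + 1))"
  have h: "h > 0" "L * h \<le> 1 / 2" using L0 by (auto simp: h_def field_simps)
  \<comment> \<open>Integrating only up to \<open>clip t\<close> makes every image constant outside
    \<open>{0..h}\<close>, hence bounded, without changing it inside.\<close>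
  define clip where "clip t = max 0 (min h t)" for t :: real
  have clip: "clip t \<in> {0..h}" for t using h by (auto simp: clip_def)
  have contF: "continuous_on S (\<lambda>s. F (apply_bcontfun g s))" for S and g :: "real \<Rightarrow>\<^sub>C 'a"
    by (rule continuous_on_compose2[OF lipschitz_on_continuous_on[OF L]]) (auto intro: continuous_on_subset[OF continuous_on_apply_bcontfun])
  define I where "I g t = x0 + integral {0..clip t} (\<lambda>s. F (apply_bcontfun g s))" for g :: "real \<Rightarrow>\<^sub>C 'a" and t
  have bcf: "I g \<in> bcontfun" for g
  proof -
    have c: "continuous_on {0..h} (\<lambda>x. x0 + integral {0..x} (\<lambda>s. F (apply_bcontfun g s)))"
      by (intro continuous_intros indefinite_integral_continuous_1 integrable_continuous_real contF)
    have "continuous_on UNIV (I g)" unfolding I_def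
      by (rule continuous_on_compose2[OF c, of UNIV clip]) (use clip in \<open>auto simp: clip_def intro!: continuous_intros\<close>)
    moreover have "bounded (range (I g))"
      using compact_imp_bounded[OF compact_continuous_image[OF c compact_Icc]]
      by (rule bounded_subset) (use clip in \<open>auto simp: I_def\<close>)
    ultimately show ?thesis by (simp add: bcontfun_def)
  qed
  have app: "apply_bcontfun (Bcontfun (I g)) = I g" for g using bcf by (simp add: Bcontfun_inverse)
  have "\<exists>!z. Bcontfun (I z) = z"
  proof (rule banach_fix_type[of "1 / 2"], safe)
    fix g1 g2 :: "real \<Rightarrow>\<^sub>C 'a"
    show "dist (Bcontfun (I g1)) (Bcontfun (I g2)) \<le> 1 / 2 * dist g1 g2"
    proof (rule dist_bound, unfold app)
      fix t
      have int: "(\<lambda>s. F (apply_bcontfun g s)) integrable_on {0..clip t}" for g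
        by (intro integrable_continuous_real contF)
      have "dist (I g1 t) (I g2 t) = norm (integral {0..clip t} (\<lambda>s. F (apply_bcontfun g1 s) - F (apply_bcontfun g2 s)))"
        by (simp add: I_def dist_norm integral_diff[OF int int])
      also have "\<dots> \<le> (L * dist g1 g2) * (clip t - 0)"
      proof (rule integral_bound)
        fix s
        have "norm (F (apply_bcontfun g1 s) - F (apply_bcontfun g2 s)) \<le> L * dist (apply_bcontfun g1 s) (apply_bcontfun g2 s)"
          using lipschitz_onD[OF L] by (simp add: dist_norm)
        also have "\<dots> \<le> L * dist g1 g2" by (intro mult_left_mono dist_bounded L0)
        finally show "norm (F (apply_bcontfun g1 s) - F (apply_bcontfun g2 s)) \<le> L * dist g1 g2" .
      qed (use clip in \<open>auto intro!: continuous_intros contF\<close>)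
      also have "\<dots> \<le> (L * dist g1 g2) * h" using clip[of t] L0 by (intro mult_left_mono) auto
      also have "\<dots> \<le> 1 / 2 * dist g1 g2" using mult_right_mono[OF h(2), of "dist g1 g2"] by (simp add: ac_simps)
      finally show "dist (I g1 t) (I g2 t) \<le> 1 / 2 * dist g1 g2" .
    qed
  qed auto
  then obtain g where g: "Bcontfun (I g) = g" by blast
  then have z: "apply_bcontfun g = I g" using app[of g] by simp
  show ?thesis
  proof (rule that[of h "apply_bcontfun g", OF h(1)])
    show "apply_bcontfun g 0 = x0" using h by (subst z) (simp add: I_def clip_def)
    fix t assume t: "t \<in> {0..h}"
    have "((\<lambda>u. x0 + integral {0..u} (\<lambda>s. F (apply_bcontfun g s))) has_vector_derivative F (apply_bcontfun g t)) (at t within {0..h})"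
      using integral_has_vector_derivative[OF contF t] by (auto intro!: derivative_eq_intros)
    then show "(apply_bcontfun g has_vector_derivative F (apply_bcontfun g t)) (at t within {0..h})"
      by (rule has_vector_derivative_transform[OF t, rotated]) (subst z, simp add: I_def clip_def)
  qed
qed

lemma vector_derivative_imp_lipschitz:
  fixes y :: "real \<Rightarrow> 'a::real_normed_vector"
  assumes "\<And>t. t \<in> {a..b} \<Longrightarrow> (y has_vector_derivative y' t) (at t within {a..b})"
    and "continuous_on {a..b} y'"
  shows "\<exists>L. L-lipschitz_on {a..b} y"
proof -
  have "bounded (y' ` {a..b})" by (intro compact_imp_bounded compact_continuous_image assms) auto
  then obtain L where L: "L > 0" "\<And>t. t \<in> {a..b} \<Longrightarrow> norm (y' t) \<le> L" by (auto simp: bounded_pos)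
  have "L-lipschitz_on {a..b} y"
  proof (rule bounded_derivative_imp_lipschitz)
    show "(y has_derivative (\<lambda>s. s *\<^sub>R y' t)) (at t within {a..b})" if "t \<in> {a..b}" for t
      using assms(1)[OF that] by (simp add: has_vector_derivative_def)
    show "onorm (\<lambda>s. s *\<^sub>R y' t) \<le> L" if "t \<in> {a..b}" for t
    proof (rule onorm_le)
      fix s :: real
      have "norm (s *\<^sub>R y' t) = norm (y' t) * norm s" by simp
      also have "\<dots> \<le> L * norm s" using L(2)[OF that] by (intro mult_right_mono) auto
      finally show "norm (s *\<^sub>R y' t) \<le> L * norm s" .
    qed
  qed (use L in auto)
  then show ?thesis ..
qed

lemma sat1_eq: "u > 0 \<Longrightarrow> sat1 u s = max (- u) (min s u)"
  by (auto simp: sat1_def sgn_if min_def max_def)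

text \<open>Each component is clamped to a symmetric interval, which never increases the distance
  between two numbers.\<close>

lemma satv_lipschitz:
  assumes "\<forall>i. ub $ i > 0"
  shows "1-lipschitz_on UNIV (satv ub)"
proof (rule lipschitz_onI)
  fix v w :: "real ^ 'a"
  have "norm (satv ub v - satv ub w) \<le> norm (v - w)"
  proof (rule norm_le_componentwise_cart)
    fix i
    have "ub $ i > 0" using assms by simp
    then show "norm ((satv ub v - satv ub w) $ i) \<le> norm ((v - w) $ i)"
      by (simp add: satv_def sat1_eq)
  qed
  then show "dist (satv ub v) (satv ub w) \<le> 1 * dist v w" by (simp add: dist_norm)
qed simp

lemma bounded_linear_closed_loop:
  "bounded_linear (Acl A B K)" "bounded_linear (Bcl B)" "bounded_linear (Kcl K)"
proof -
  note bl = bounded_linear_compose[OF matrix_vector_mul_bounded_linear]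
  show "bounded_linear (Acl A B K)" unfolding Acl_def[abs_def]
    by (intro bounded_linear_Pair bounded_linear_sub bl bounded_linear_fst bounded_linear_snd)
  show "bounded_linear (Bcl B)" unfolding Bcl_def[abs_def]
    by (intro bounded_linear_Pair matrix_vector_mul_bounded_linear bounded_linear_zero)
  show "bounded_linear (Kcl K)" unfolding Kcl_def[abs_def]
    by (intro bounded_linear_sub bl bounded_linear_fst bounded_linear_snd)
qed

lemma closed_loop_field_lipschitz:
  assumes "\<forall>i. ub $ i > 0"
  obtains L where "L-lipschitz_on UNIV (\<lambda>z. Acl A B K z + Bcl B (dzv ub (Kcl K z)))"
proof -
  obtain a where a: "a-lipschitz_on UNIV (Acl A B K)"
    using bounded_linear.lipschitz_boundE[OF bounded_linear_closed_loop(1)] by blast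
  obtain b where b: "b-lipschitz_on UNIV (Bcl B)"
    using bounded_linear.lipschitz_boundE[OF bounded_linear_closed_loop(2)] by blast
  obtain c where c: "c-lipschitz_on UNIV (Kcl K)"
    using bounded_linear.lipschitz_boundE[OF bounded_linear_closed_loop(3)] by blast
  have d: "(1 + 1)-lipschitz_on UNIV (dzv ub)"
    unfolding dzv_def[abs_def] by (intro lipschitz_on_diff satv_lipschitz assms lipschitz_on_id)
  have "(a + b * ((1 + 1) * c))-lipschitz_on UNIV (\<lambda>z. Acl A B K z + Bcl B (dzv ub (Kcl K z)))"
    by (intro lipschitz_on_add a lipschitz_on_compose2[OF lipschitz_on_compose2[OF c]]
        lipschitz_on_subset[OF b] lipschitz_on_subset[OF d]) auto
  then show ?thesis by (rule that)
qed

lemma continuous_on_fcl: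
  assumes "\<forall>i. ub $ i > 0"
  shows "continuous_on S (fcl A B K ub)"
proof -
  obtain L where "L-lipschitz_on UNIV (\<lambda>z. Acl A B K z + Bcl B (dzv ub (Kcl K z)))"
    using closed_loop_field_lipschitz[OF assms] .
  from continuous_on_compose2[OF lipschitz_on_continuous_on[OF this] continuous_on_fst[OF continuous_on_id], of S]
  show ?thesis unfolding fcl_def[abs_def] by (intro continuous_on_Pair continuous_on_const) auto
qed

section \<open>Flow set, jump set and attractor\<close>

lemma Tset_eq_cbox: "Tset T2 = cbox 0 T2"
  by (auto simp: Tset_def mem_box_cart)

lemma closed_Ccl: "closed (Ccl T2)"
  unfolding Ccl_def Tset_eq_cbox by (intro closed_Times closed_cbox closed_UNIV)

lemma Dcl_subset_Ccl: "Dcl T2 \<subseteq> Ccl T2"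
  by (auto simp: Dcl_def Ccl_def Dset_def)

lemma Gcl_subset_Ccl:
  assumes "\<forall>i. 0 < T1 $ i" "x \<in> Dcl T2"
  shows "Gcl blk T1 T2 x \<subseteq> Ccl T2"
proof
  fix g assume "g \<in> Gcl blk T1 T2 x"
  then obtain i where i: "snd x \<in> Tset T2" "snd g \<in> Ghat T1 T2 i (snd x)"
    by (auto simp: Gcl_def Dset_def)
  have "0 \<le> snd g $ k \<and> snd g $ k \<le> T2 $ k" for k
    using i assms(1)[rule_format, of i] by (cases "k = i") (auto simp: Ghat_def Tset_def)
  then show "g \<in> Ccl T2" by (cases g) (auto simp: Ccl_def Tset_def)
qed

lemma Gcl_nonempty:
  assumes "\<forall>i. T1 $ i \<le> T2 $ i" "x \<in> Dcl T2"
  shows "Gcl blk T1 T2 x \<noteq> {}"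
proof -
  obtain i where i: "snd x \<in> Dset T2 i" using assms(2) by (auto simp: Dcl_def)
  have "(\<chi> k. if k = i then T2 $ i else snd x $ k) \<in> Ghat T1 T2 i (snd x)"
    using assms(1) by (simp add: Ghat_def)
  then show ?thesis using i unfolding Gcl_def by blast
qed

text \<open>The nearest point of the attractor is \<open>(0, snd x)\<close>, because the timers of a
  point of the flow set already lie in \<open>Tset T2\<close>. The timers thus contribute nothing to
  the distance.\<close>

lemma infdist_Acl_set:
  assumes "x \<in> Ccl T2"
  shows "infdist x (Acl_set T2) = norm (fst x)"
proof (rule antisym)
  have x: "(0, snd x) \<in> Acl_set T2" using assms by (auto simp: Acl_set_def Ccl_def)
  then have "infdist x (Acl_set T2) \<le> dist x (0, snd x)" by (rule infdist_le)
  then show "infdist x (Acl_set T2) \<le> norm (fst x)" by (cases x) (simp add: dist_Pair_Pair)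
  show "norm (fst x) \<le> infdist x (Acl_set T2)"
  proof -
    have "norm (fst x) \<le> dist x a" if "a \<in> Acl_set T2" for a
      using dist_fst_le[of x a] that by (auto simp: Acl_set_def)
    then show ?thesis using x unfolding infdist_def by (auto intro!: cINF_greatest)
  qed
qed

lemma fcl_timer: "w \<bullet> snd (fcl A B K ub x) = - (\<Sum>i\<in>UNIV. w $ i)"
  by (simp add: fcl_def inner_vec_def sum_negf)

text \<open>Timers fall at unit rate, so a vanishing timer would turn negative at once and the flow
  would leave \<open>Ccl T2\<close>.\<close>

lemma no_flow_from_Dcl:
  fixes y :: "real \<Rightarrow> ((real^'n) \<times> (real^'n)) \<times> (real^'q)"
  assumes "a < b" and fl: "flow_on (Ccl T2) (fcl A B K ub) a b y"
  shows "y a \<notin> Dcl T2"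
proof
  assume "y a \<in> Dcl T2"
  then obtain i where i: "snd (y a) $ i = 0" by (auto simp: Dcl_def Dset_def)
  \<comment> \<open>An interior time, since \<open>flow_on\<close> places the curve in the flow set
    only strictly between the endpoints.\<close>
  define m where "m = (a + b) / 2"
  have m: "a < m" "m < b" using assms(1) by (auto simp: m_def)
  have "(0, axis i 1) \<bullet> y m - (0, axis i 1) \<bullet> y a \<le> (- 1) * (m - a)"
  proof (rule flow_on_linear_le[OF flow_on_subinterval[OF fl]])
    show "(0, axis i 1) \<bullet> fcl A B K ub (y t) \<le> - 1" for t
      by (simp add: inner_prod_def fcl_timer) (simp add: axis_def)
  qed (use m in auto)
  then have "snd (y m) $ i < 0"
    using i m by (simp add: inner_prod_def inner_axis')
  moreover have "y m \<in> Ccl T2" using fl m by (simp add: flow_on_def)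
  then have "0 \<le> snd (y m) $ i" by (auto simp: Ccl_def Tset_def)
  ultimately show False by simp
qed

text \<open>The timers decouple: they run down linearly, while the remaining components solve a
  Lipschitz equation of their own.\<close>

lemma closed_loop_local_flow:
  fixes x :: "((real^'n) \<times> (real^'n)) \<times> (real^'q)"
  assumes ub: "\<forall>i. ub $ i > 0" and x: "x \<in> Ccl T2 - Dcl T2"
  shows "\<exists>h>0. \<exists>L y. y 0 = x \<and> L-lipschitz_on {0..h} y \<and>
     (\<forall>t\<in>{0<..<h}. y t \<in> Ccl T2 \<and> (y has_vector_derivative fcl A B K ub (y t)) (at t))"
proof -
  define F where "F z = Acl A B K z + Bcl B (dzv ub (Kcl K z))" for z
  obtain L where "L-lipschitz_on UNIV F"
    using closed_loop_field_lipschitz[OF ub] unfolding F_def[abs_def] by blast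
  then obtain h z where h: "h > 0" and z0: "z 0 = fst x"
    and z: "\<And>t. t \<in> {0..h} \<Longrightarrow> (z has_vector_derivative F (z t)) (at t within {0..h})"
    using lipschitz_ode_local_solution by blast
  have T: "0 \<le> snd x $ i" "snd x $ i \<le> T2 $ i" for i using x by (auto simp: Ccl_def Tset_def)
  have pos: "0 < snd x $ i" for i
  proof (rule ccontr)
    assume "\<not> 0 < snd x $ i"
    then have "snd x $ i = 0" using T[of i] by simp
    then have "x \<in> Dcl T2" using T by (cases x) (auto simp: Dcl_def Dset_def Tset_def)
    then show False using x by simp
  qed
  \<comment> \<open>Up to this time the local solution exists and no timer becomes negative.\<close>
  define h' where "h' = Min (insert h (range (($) (snd x))))"
  have h': "0 < h'" "h' \<le> h" "\<And>i. h' \<le> snd x $ i"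
    using h pos unfolding h'_def by (auto simp del: Min_insert intro: Min_le)
  define y where "y t = (z t, snd x - t *\<^sub>R 1)" for t
  have fy: "fcl A B K ub (y t) = (F (z t), - 1)" for t
    by (simp add: fcl_def y_def F_def vec_eq_iff)
  have y: "(y has_vector_derivative fcl A B K ub (y t)) (at t within {0..h'})" if "t \<in> {0..h'}" for t
    unfolding fy unfolding y_def
  proof (rule has_vector_derivative_Pair)
    show "(z has_vector_derivative F (z t)) (at t within {0..h'})"
      using that h' by (intro has_vector_derivative_within_subset[OF z]) auto
    show "((\<lambda>t. snd x - t *\<^sub>R 1) has_vector_derivative - 1) (at t within {0..h'})"
      by (auto intro!: derivative_eq_intros)
  qed
  have "continuous_on {0..h'} y"
    using y by (intro continuous_on_vector_derivative)
  then have "continuous_on {0..h'} (\<lambda>t. fcl A B K ub (y t))"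
    by (rule continuous_on_compose2[OF continuous_on_fcl[OF ub, of UNIV]]) auto
  then obtain L where "L-lipschitz_on {0..h'} y" using vector_derivative_imp_lipschitz[OF y] by blast
  moreover have "y 0 = x" by (simp add: y_def z0)
  moreover have "y t \<in> Ccl T2 \<and> (y has_vector_derivative fcl A B K ub (y t)) (at t)" if "t \<in> {0<..<h'}" for t
  proof
    have "0 \<le> snd x $ i - t \<and> snd x $ i - t \<le> T2 $ i" for i
      using T[of i] h'(3)[of i] that by simp
    then show "y t \<in> Ccl T2" by (simp add: y_def Ccl_def Tset_def)
    show "(y has_vector_derivative fcl A B K ub (y t)) (at t)"
      using y[of t] that at_within_Icc_at[of 0 t h'] by simp
  qed
  ultimately show ?thesis using h'(1) by blast
qed

section \<open>Decay of the Lyapunov function\<close>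

lemma powr_le_mult_powrD:
  fixes x z d k :: real
  assumes "x powr k \<le> d * z powr k" "0 \<le> x" "0 \<le> z" "0 < d" "0 < k"
  shows "x \<le> d powr (1 / k) * z"
proof -
  have "(x powr k) powr (1 / k) \<le> (d * z powr k) powr (1 / k)"
    using assms by (intro powr_mono2) auto
  also have "\<dots> = d powr (1 / k) * (z powr k) powr (1 / k)"
    using assms by (simp add: powr_mult)
  finally show ?thesis using assms by (simp add: powr_powr)
qed

text \<open>The weight \<open>1 / T1 $ i\<close> is the one for which resetting timer
  \<open>i\<close> from \<open>0\<close> to at least \<open>T1 $ i\<close> gains at least one. On
  the flow set the weighted sum lies between \<open>0\<close> and the first sum of the bound, so the
  jumps cannot outnumber this reserve plus what flows consume.\<close>

lemma closed_loop_jump_count: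
  fixes \<phi> :: "real \<times> nat \<Rightarrow> ((real^'n) \<times> (real^'n)) \<times> (real^'q)"
  assumes T1: "\<forall>i. 0 < T1 $ i"
    and sol: "is_solution (Ccl T2) (fcl A B K ub) (Dcl T2) (Gcl blk T1 T2) E \<phi>" and tj: "(t, j) \<in> E"
  shows "real j \<le> (\<Sum>i\<in>UNIV. T2 $ i / T1 $ i) + (\<Sum>i\<in>UNIV. 1 / T1 $ i) * t"
proof -
  define w :: "real^'q" where "w = (\<chi> i. 1 / T1 $ i)"
  have inC: "\<phi> (t, j) \<in> Ccl T2" if "(t, j) \<in> E" for t j
    using solution_in_flow_set[OF sol closed_Ccl Dcl_subset_Ccl Gcl_subset_Ccl[OF T1] that] .
  have "real j + w \<bullet> snd (\<phi> (0, 0)) \<le> (\<Sum>i\<in>UNIV. 1 / T1 $ i) * t + w \<bullet> snd (\<phi> (t, j))"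
    using sol tj
  proof (induction rule: solution_induct)
    case init then show ?case by simp
  next
    case (flow a b j)
    \<comment> \<open>The sign is reversed because \<open>flow_on_linear_le\<close> gives upper
      bounds, whereas the weighted sum must be shown not to fall any faster.\<close>
    have "(0, - w) \<bullet> \<phi> (b, j) - (0, - w) \<bullet> \<phi> (a, j) \<le> (\<Sum>i\<in>UNIV. 1 / T1 $ i) * (b - a)"
    proof (rule flow_on_linear_le[OF solution_flow_on[OF sol flow(2)]])
      show "(0, - w) \<bullet> fcl A B K ub (\<phi> (t, j)) \<le> (\<Sum>i\<in>UNIV. 1 / T1 $ i)" for t
        by (simp add: inner_prod_def fcl_timer) (simp add: w_def sum_negf)
    qed (use flow in simp)
    then show ?case using flow(3) by (simp add: inner_prod_def algebra_simps)
  next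
    case (jump t j)
    have "\<phi> (t, Suc j) \<in> Gcl blk T1 T2 (\<phi> (t, j))"
      using sol jump(1,2) unfolding is_solution_def by blast
    then obtain i where i: "snd (\<phi> (t, j)) $ i = 0" "snd (\<phi> (t, Suc j)) \<in> Ghat T1 T2 i (snd (\<phi> (t, j)))"
      by (auto simp: Gcl_def Dset_def)
    have eq: "w \<bullet> v = v $ i / T1 $ i + (\<Sum>k\<in>UNIV - {i}. v $ k / T1 $ k)" for v
      by (simp add: inner_vec_def w_def sum.remove[of UNIV i])
    have "(\<Sum>k\<in>UNIV - {i}. snd (\<phi> (t, Suc j)) $ k / T1 $ k) = (\<Sum>k\<in>UNIV - {i}. snd (\<phi> (t, j)) $ k / T1 $ k)"
      using i(2) by (intro sum.cong) (auto simp: Ghat_def)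
    moreover have "1 \<le> snd (\<phi> (t, Suc j)) $ i / T1 $ i"
      using i(2) T1 by (simp add: Ghat_def)
    ultimately have "w \<bullet> snd (\<phi> (t, j)) + 1 \<le> w \<bullet> snd (\<phi> (t, Suc j))"
      unfolding eq using i(1) by simp
    then show ?case using jump(3) by simp
  qed
  moreover have "0 \<le> w \<bullet> snd (\<phi> (0, 0))"
  proof -
    have "\<phi> (0, 0) \<in> Ccl T2" using inC sol by (simp add: is_solution_def hybrid_arc_def htd_def)
    then show ?thesis using T1 by (auto simp: inner_vec_def w_def Ccl_def Tset_def less_imp_le intro!: sum_nonneg)
  qed
  moreover have "w \<bullet> snd (\<phi> (t, j)) \<le> (\<Sum>i\<in>UNIV. T2 $ i / T1 $ i)"
    unfolding inner_vec_def w_def using inC[OF tj] T1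
    by (auto simp: Ccl_def Tset_def less_imp_le intro!: sum_mono divide_right_mono)
  ultimately show ?thesis by simp
qed

text \<open>The bounds on \<open>V\<close> are phrased through \<open>norm (fst x)\<close>, which by
  \<open>infdist_Acl_set\<close> is the distance to the attractor on the flow set; this keeps
  \<open>infdist\<close> out of the estimates.\<close>

locale closed_loop_lyapunov =
  fixes blk :: "'n::finite \<Rightarrow> 'q::finite"
    and A :: "real^'n^'n" and B :: "real^'m^'n" and K :: "real^'n^'m" and ub :: "real^'m"
    and T1 T2 :: "real^'q"
    and V :: "((real^'n) \<times> (real^'n)) \<times> (real^'q) \<Rightarrow> real"
    and gradV :: "((real^'n) \<times> (real^'n)) \<times> (real^'q) \<Rightarrow> ((real^'n) \<times> (real^'n)) \<times> (real^'q)"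
    and k c1 c2 c3 :: real
    and U :: "((real^'n) \<times> (real^'n)) set"
  assumes ub_pos: "\<forall>i. ub $ i > 0"
    and T1_pos: "\<forall>i. 0 < T1 $ i" and T1_le_T2: "\<forall>i. T1 $ i \<le> T2 $ i"
    and V_deriv: "\<And>x. (V has_derivative (\<lambda>h. gradV x \<bullet> h)) (at x)"
    and gradV_cont: "continuous_on UNIV gradV"
    and consts_pos: "k > 0" "c1 > 0" "c2 > 0" "c3 > 0"
    and U_nhd: "0 \<in> interior U"
    and V_lower: "\<And>x. x \<in> Ccl T2 \<Longrightarrow> c1 * norm (fst x) powr k \<le> V x"
    and V_upper: "\<And>x. x \<in> Ccl T2 \<Longrightarrow> V x \<le> c2 * norm (fst x) powr k"
    and V_flow: "\<And>x. x \<in> U \<times> Tset T2 \<Longrightarrow> gradV x \<bullet> fcl A B K ub x \<le> - c3 * V x"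
    and V_jump: "\<And>x g. x \<in> Dcl T2 \<Longrightarrow> g \<in> Gcl blk T1 T2 x \<Longrightarrow> V g \<le> V x"
begin

abbreviation "C \<equiv> Ccl T2 :: (((real^'n) \<times> (real^'n)) \<times> (real^'q)) set"
abbreviation "D \<equiv> Dcl T2 :: (((real^'n) \<times> (real^'n)) \<times> (real^'q)) set"
abbreviation "f \<equiv> fcl A B K ub :: ((real^'n) \<times> (real^'n)) \<times> (real^'q) \<Rightarrow> _"
abbreviation "G \<equiv> Gcl blk T1 T2"

lemma V_nonneg: "x \<in> C \<Longrightarrow> 0 \<le> V x"
  using V_lower[of x] consts_pos by (meson mult_nonneg_nonneg order_trans less_imp_le powr_ge_zero)

lemma continuous_on_V: "continuous_on S V"
  using V_deriv by (meson continuous_at_imp_continuous_on has_derivative_continuous)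

text \<open>The set \<open>U\<close> need not be open, so near a point of \<open>U\<close> off the attractor only the sign of the
  derivative survives; on the attractor, \<open>U\<close> contains a neighbourhood.\<close>

lemma V_descent_nearby:
  assumes x: "x \<in> U \<times> Tset T2"
  shows "\<exists>r>0. \<forall>x'\<in>C. dist x' x < r \<longrightarrow> gradV x' \<bullet> f x' \<le> 0"
proof (cases "fst x = 0")
  case True
  obtain r where r: "r > 0" "ball 0 r \<subseteq> U" using U_nhd by (meson mem_interior)
  show ?thesis
  proof (intro exI[of _ r] conjI ballI impI r(1))
    fix x' assume x': "x' \<in> C" "dist x' x < r"
    have "dist (fst x') 0 < r" using dist_fst_le[of x' x] x'(2) True by simp
    then have "x' \<in> U \<times> Tset T2" using r(2) x'(1) by (cases x') (auto simp: Ccl_def dist_commute)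
    then have "gradV x' \<bullet> f x' \<le> - c3 * V x'" by (rule V_flow)
    also have "\<dots> \<le> 0" using V_nonneg[OF x'(1)] consts_pos by simp
    finally show "gradV x' \<bullet> f x' \<le> 0" .
  qed
next
  case False
  have "x \<in> C" using x by (auto simp: Ccl_def)
  then have "c1 * norm (fst x) powr k \<le> V x" by (rule V_lower)
  moreover have "0 < c1 * norm (fst x) powr k" using False consts_pos by simp
  ultimately have "0 < V x" by simp
  then have "gradV x \<bullet> f x < 0" using V_flow[OF x] consts_pos by (smt (verit) mult_pos_pos mult_minus_left)
  moreover have "continuous_on UNIV (\<lambda>x. gradV x \<bullet> f x)"
    by (intro continuous_intros gradV_cont continuous_on_fcl ub_pos)
  ultimately obtain r where "r > 0" "\<forall>x'. dist x' x < r \<longrightarrow> dist (gradV x' \<bullet> f x') (gradV x \<bullet> f x) < - (gradV x \<bullet> f x)"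
    unfolding continuous_on_iff by (metis UNIV_I neg_0_less_iff_less)
  moreover have "gradV x' \<bullet> f x' \<le> 0" if "dist (gradV x' \<bullet> f x') (gradV x \<bullet> f x) < - (gradV x \<bullet> f x)" for x'
    using that by (simp add: dist_real_def)
  ultimately show ?thesis by blast
qed

text \<open>At the last time \<open>s\<close> up to \<open>t\<close> with
  \<open>V (y s) \<le> c\<close> the state is still in \<open>U \<times> Tset T2\<close>, so
  \<open>V_descent_nearby\<close> makes \<open>V\<close> nonincreasing shortly afterwards, against
  \<open>V > c\<close> right after \<open>s\<close>. \<open>V_flow\<close> cannot be invoked past
  \<open>s\<close>, where the curve may have left \<open>U\<close>.\<close>

lemma flow_stays_in_sublevel:
  assumes fl: "flow_on C f a b y" and ab: "a < b" and sub: "{x \<in> C. V x \<le> c} \<subseteq> U \<times> Tset T2"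
    and ya: "V (y a) \<le> c" and t: "t \<in> {a..b}"
  shows "V (y t) \<le> c"
proof (rule ccontr)
  assume nt: "\<not> V (y t) \<le> c"
  have yC: "y u \<in> C" if "u \<in> {a..b}" for u using flow_on_endpoints[OF fl closed_Ccl ab that] .
  have "abs_cont_on {a..b} y" using fl by (simp add: flow_on_def)
  then have cy: "continuous_on {a..b} y" by (rule abs_cont_on_imp_continuous_on)
  then have cVy: "continuous_on {a..t} (\<lambda>u. V (y u))"
    using t by (intro continuous_on_compose2[OF continuous_on_V[of UNIV]] continuous_on_subset[OF cy]) auto
  define S where "S = {u \<in> {a..t}. V (y u) \<le> c}"
  have "closed S"
    unfolding S_def using cVy by (intro continuous_on_closed_Collect_le continuous_on_const closed_atLeastAtMost)
  moreover have S: "a \<in> S" "S \<subseteq> {a..t}" using ya t by (auto simp: S_def)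
  moreover have bdd: "bdd_above S" using S(2) by (rule bdd_above_mono[rotated]) simp
  ultimately have Sup: "Sup S \<in> S" by (intro closed_contains_Sup) auto
  define s where "s = Sup S"
  have s: "a \<le> s" "s < t" "V (y s) \<le> c" using Sup nt by (auto simp: s_def S_def less_le)
  have after: "c < V (y u)" if "s < u" "u \<le> t" for u
  proof (rule ccontr)
    assume "\<not> c < V (y u)"
    then have "u \<in> S" using that s(1) by (simp add: S_def)
    then show False using cSup_upper[OF _ bdd, of u] that(1) by (simp add: s_def)
  qed
  have sab: "s \<in> {a..b}" using s t by auto
  then have "y s \<in> U \<times> Tset T2" using sub s(3) yC by auto
  from V_descent_nearby[OF this]
  obtain r where r: "r > 0" "\<forall>x'\<in>C. dist x' (y s) < r \<longrightarrow> gradV x' \<bullet> f x' \<le> 0"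
    by (elim exE conjE)
  from cy[unfolded continuous_on_iff, THEN bspec, OF sab] r(1)
  obtain d where d: "d > 0" "\<forall>u\<in>{a..b}. dist u s < d \<longrightarrow> dist (y u) (y s) < r"
    by blast
  \<comment> \<open>Late enough for \<open>after\<close> to give \<open>V (y u) > c\<close>, early
    enough for the curve to stay where \<open>V\<close> descends.\<close>
  define u where "u = min t (s + d / 2)"
  have u: "s < u" "u \<le> t" "u < s + d" using s d(1) by (auto simp: u_def)
  have "(\<lambda>p::real \<times> _. V (snd p)) (u, y u) \<le> (\<lambda>p::real \<times> _. V (snd p)) (s, y s)"
  proof (rule flow_on_nonincreasing[OF flow_on_subinterval[OF fl], where gH = "\<lambda>p. (0, gradV (snd p))"])
    show "((\<lambda>p::real \<times> _. V (snd p)) has_derivative (\<bullet>) (0, gradV (snd x))) (at x)" for x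
    proof -
      have "((\<lambda>p::real \<times> _. V (snd p)) has_derivative (\<lambda>h. gradV (snd x) \<bullet> snd h)) (at x)"
        by (rule has_derivative_compose[OF has_derivative_snd[OF has_derivative_ident] V_deriv])
      moreover have "(\<lambda>h::real \<times> _. gradV (snd x) \<bullet> snd h) = (\<bullet>) (0, gradV (snd x))"
        by (simp add: fun_eq_iff)
      ultimately show ?thesis by simp
    qed
    show "continuous_on UNIV (\<lambda>p::real \<times> _. (0::real, gradV (snd p)))"
      by (intro continuous_intros continuous_on_compose2[OF gradV_cont]) auto
    fix v assume "v \<in> {s<..<u}"
    then have "v \<in> {a..b}" "dist v s < d" using s t u by (auto simp: dist_real_def)
    then show "(0, gradV (snd (v, y v))) \<bullet> (1, f (y v)) \<le> 0" using r(2) yC d(2) by simp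
  qed (use s t u in auto)
  then show False using after[OF u(1,2)] s(3) by simp
qed

lemma flow_decay:
  assumes fl: "flow_on C f a b y" and ab: "a < b" and sub: "{x \<in> C. V x \<le> c} \<subseteq> U \<times> Tset T2"
    and ya: "V (y a) \<le> c"
  shows "exp (c3 * b) * V (y b) \<le> exp (c3 * a) * V (y a)"
proof -
  have "(\<lambda>p. exp (c3 * fst p) * V (snd p)) (b, y b) \<le> (\<lambda>p. exp (c3 * fst p) * V (snd p)) (a, y a)"
  proof (rule flow_on_nonincreasing[OF fl, where gH = "\<lambda>p. (c3 * exp (c3 * fst p) * V (snd p), exp (c3 * fst p) *\<^sub>R gradV (snd p))"])
    show "((\<lambda>p. exp (c3 * fst p) * V (snd p)) has_derivative
        (\<bullet>) (c3 * exp (c3 * fst x) * V (snd x), exp (c3 * fst x) *\<^sub>R gradV (snd x))) (at x)" for x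
      by (auto intro!: derivative_eq_intros has_derivative_compose[OF has_derivative_snd[OF has_derivative_ident] V_deriv]
          simp: inner_prod_def fun_eq_iff algebra_simps)
    show "continuous_on UNIV (\<lambda>p. (c3 * exp (c3 * fst p) * V (snd p), exp (c3 * fst p) *\<^sub>R gradV (snd p)))"
      by (intro continuous_intros continuous_on_compose2[OF gradV_cont] continuous_on_compose2[OF continuous_on_V[of UNIV]]) auto
    fix t assume "t \<in> {a<..<b}"
    then have t: "t \<in> {a..b}" by simp
    \<comment> \<open>Invariance of the sublevel set is what makes \<open>V_flow\<close> applicable
      at every interior time.\<close>
    have "y t \<in> U \<times> Tset T2"
      using flow_stays_in_sublevel[OF fl ab sub ya t] flow_on_endpoints[OF fl closed_Ccl ab t] sub by blast
    then have "exp (c3 * t) * (gradV (y t) \<bullet> f (y t)) \<le> exp (c3 * t) * (- c3 * V (y t))"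
      by (intro mult_left_mono V_flow) auto
    then show "(c3 * exp (c3 * fst (t, y t)) * V (snd (t, y t)), exp (c3 * fst (t, y t)) *\<^sub>R gradV (snd (t, y t))) \<bullet> (1, f (y t)) \<le> 0"
      by (simp add: algebra_simps)
  qed (use ab in simp)
  then show ?thesis by simp
qed

section \<open>Solutions starting in a sublevel set inside \<open>U \<times> Tset T2\<close>\<close>

context
  fixes E \<phi> c
  assumes sol: "is_solution C f D G E \<phi>" and sub: "{x \<in> C. V x \<le> c} \<subseteq> U \<times> Tset T2"
    and start: "V (\<phi> (0, 0)) \<le> c"
begin

lemma solution_in_C: "(t, j) \<in> E \<Longrightarrow> \<phi> (t, j) \<in> C"
  using solution_in_flow_set[OF sol closed_Ccl Dcl_subset_Ccl Gcl_subset_Ccl[OF T1_pos]] .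

lemma origin_in_domain: "(0, 0) \<in> E" and domain_nonneg: "(t, j) \<in> E \<Longrightarrow> 0 \<le> t"
  using sol by (auto simp: is_solution_def hybrid_arc_def htd_def)

lemma solution_V_decay:
  assumes "(t, j) \<in> E"
  shows "V (\<phi> (t, j)) \<le> exp (- c3 * t) * V (\<phi> (0, 0)) \<and> V (\<phi> (t, j)) \<le> c"
proof -
  have V0: "0 \<le> V (\<phi> (0, 0))" using V_nonneg solution_in_C origin_in_domain by blast
  \<comment> \<open>The induction carries only the exponential bound; from it this recovers the
    sublevel bound that \<open>flow_decay\<close> needs at the start of each flow.\<close>
  have dec_le: "exp (- c3 * t) * V (\<phi> (0, 0)) \<le> c" if "(t, j) \<in> E" for t j
  proof -
    have "exp (- c3 * t) * V (\<phi> (0, 0)) \<le> 1 * V (\<phi> (0, 0))"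
      using V0 domain_nonneg[OF that] consts_pos by (intro mult_right_mono) auto
    then show ?thesis using start by simp
  qed
  have "exp (c3 * t) * V (\<phi> (t, j)) \<le> V (\<phi> (0, 0))"
    using sol assms
  proof (induction rule: solution_induct)
    case init then show ?case by simp
  next
    case (flow a b j)
    then have aE: "(a, j) \<in> E" by auto
    have "V (\<phi> (a, j)) \<le> exp (- c3 * a) * V (\<phi> (0, 0))"
      using flow(3) by (simp add: exp_minus field_simps)
    then have "V (\<phi> (a, j)) \<le> c" using dec_le[OF aE] by simp
    from flow_decay[OF solution_flow_on[OF sol flow(2)] flow(1) sub this] flow(3) show ?case by simp
  next
    case (jump t j)
    then have "V (\<phi> (t, Suc j)) \<le> V (\<phi> (t, j))"
      using sol V_jump unfolding is_solution_def by blast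
    then have "exp (c3 * t) * V (\<phi> (t, Suc j)) \<le> exp (c3 * t) * V (\<phi> (t, j))" by simp
    then show ?case using jump(3) by (rule order_trans)
  qed
  then have "V (\<phi> (t, j)) \<le> exp (- c3 * t) * V (\<phi> (0, 0))" by (simp add: exp_minus field_simps)
  then show ?thesis using dec_le[OF assms] by simp
qed

text \<open>The \<open>k\<close>-th root turns the rate \<open>c3\<close> of \<open>V\<close> into
  \<open>c3 / k\<close> for the norm. The jump count then trades \<open>t\<close> for
  \<open>t + j\<close>, which divides the rate by \<open>1 + R\<close> and costs the factor
  containing \<open>P\<close>.\<close>

lemma solution_norm_decay:
  assumes tj: "(t, j) \<in> E"
    and P: "P = (\<Sum>i\<in>UNIV. T2 $ i / T1 $ i)" and R: "R = (\<Sum>i\<in>UNIV. 1 / T1 $ i)"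
  shows "norm (fst (\<phi> (t, j))) \<le> ((c2 / c1) powr (1 / k) * exp (c3 / (k * (1 + R)) * P)) *
     exp (- (c3 / (k * (1 + R))) * (t + real j)) * norm (fst (\<phi> (0, 0)))"
proof -
  define n where "n = norm (fst (\<phi> (t, j)))"
  define n0 where "n0 = norm (fst (\<phi> (0, 0)))"
  have nn: "0 \<le> n" "0 \<le> n0" by (auto simp: n_def n0_def)
  have R0: "0 \<le> R" unfolding R using T1_pos by (intro sum_nonneg) (auto simp: less_imp_le)
  have "c1 * n powr k \<le> V (\<phi> (t, j))" unfolding n_def using V_lower[OF solution_in_C[OF tj]] .
  also have "\<dots> \<le> exp (- c3 * t) * V (\<phi> (0, 0))" using solution_V_decay[OF tj] by simp
  also have "\<dots> \<le> exp (- c3 * t) * (c2 * n0 powr k)"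
    unfolding n0_def using V_upper[OF solution_in_C[OF origin_in_domain]] by simp
  finally have "n powr k \<le> (c2 / c1) * exp (- c3 * t) * n0 powr k"
    using consts_pos by (simp add: field_simps)
  then have "n \<le> ((c2 / c1) * exp (- c3 * t)) powr (1 / k) * n0"
    using consts_pos nn by (intro powr_le_mult_powrD) auto
  also have "((c2 / c1) * exp (- c3 * t)) powr (1 / k) = (c2 / c1) powr (1 / k) * exp (- c3 * t) powr (1 / k)"
    by (rule powr_mult)
  finally have n: "n \<le> (c2 / c1) powr (1 / k) * exp (- (c3 / k) * t) * n0"
    by (simp add: exp_powr_real)
  have "t + real j \<le> P + (1 + R) * t"
    using closed_loop_jump_count[OF T1_pos sol tj] by (simp add: P R algebra_simps)
  then have "c3 / (k * (1 + R)) * (t + real j) \<le> c3 / (k * (1 + R)) * (P + (1 + R) * t)"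
    using consts_pos R0 by (intro mult_left_mono) auto
  also have "\<dots> = c3 / (k * (1 + R)) * P + c3 / k * t"
  proof -
    have "1 + R \<noteq> 0" using R0 by simp
    then show ?thesis unfolding distrib_left[of _ P] by simp
  qed
  finally have "exp (- (c3 / k) * t) \<le> exp (c3 / (k * (1 + R)) * P + - (c3 / (k * (1 + R))) * (t + real j))"
    by simp
  then have "(c2 / c1) powr (1 / k) * exp (- (c3 / k) * t) * n0
      \<le> (c2 / c1) powr (1 / k) * exp (c3 / (k * (1 + R)) * P + - (c3 / (k * (1 + R))) * (t + real j)) * n0"
    using nn by (intro mult_right_mono mult_left_mono) auto
  then show ?thesis using n unfolding exp_add n_def n0_def by (simp add: mult.assoc)
qed

text \<open>The lower bound on \<open>V\<close> confines the nontimer components to a ball and the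
  timers lie in a box, so the continuous field is evaluated on a compact set only.\<close>

lemma solution_field_bounded: "\<exists>M. \<forall>p\<in>E. norm (f (\<phi> p)) \<le> M"
proof -
  define r where "r = (c / c1) powr (1 / k)"
  have "\<phi> p \<in> cball 0 r \<times> Tset T2" if "p \<in> E" for p
  proof -
    obtain t j where p: "p = (t, j)" by fastforce
    then have pC: "\<phi> p \<in> C" using that solution_in_C by blast
    have "c1 * norm (fst (\<phi> p)) powr k \<le> c"
      using V_lower[OF pC] solution_V_decay[of t j] that p by simp
    then have "norm (fst (\<phi> p)) powr k \<le> c / c1" using consts_pos by (simp add: field_simps)
    then have "(norm (fst (\<phi> p)) powr k) powr (1 / k) \<le> r"
      unfolding r_def using consts_pos by (intro powr_mono2) auto
    then have "norm (fst (\<phi> p)) \<le> r" using consts_pos by (simp add: powr_powr)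
    then show ?thesis using pC by (cases "\<phi> p") (auto simp: Ccl_def)
  qed
  moreover have "compact (f ` (cball 0 r \<times> Tset T2))"
    unfolding Tset_eq_cbox
    by (intro compact_continuous_image continuous_on_fcl ub_pos compact_Times compact_cball compact_cbox)
  then obtain M where "\<forall>z\<in>f ` (cball 0 r \<times> Tset T2). norm z \<le> M"
    using compact_imp_bounded bounded_iff by metis
  ultimately show ?thesis by blast
qed

lemma solution_complete:
  assumes "maximal_solution C f D G E \<phi>"
  shows "complete_dom E"
proof -
  obtain M where "\<forall>p\<in>E. norm (f (\<phi> p)) \<le> M" using solution_field_bounded by blast
  then show ?thesis
  proof (intro maximal_solution_complete[OF assms])
    show "\<phi> p \<in> C" if "p \<in> E" for p using solution_in_C that by (cases p) auto
  qed (use no_flow_from_Dcl Gcl_nonempty[OF T1_le_T2] closed_loop_local_flow[OF ub_pos] in blast)+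
qed

end

text \<open>The level \<open>c2 * \<mu> powr k\<close> is the one that \<open>V_upper\<close> gives
  at distance \<open>\<mu>\<close>. By \<open>V_lower\<close> its sublevel set has norm at most
  \<open>q * \<mu> = r / 2\<close>, inside the ball of radius \<open>r\<close> contained in
  \<open>U\<close>.\<close>

lemma small_sublevel:
  obtains \<mu> where "\<mu> > 0" "{x \<in> C. V x \<le> c2 * \<mu> powr k} \<subseteq> U \<times> Tset T2"
proof -
  obtain r where r: "r > 0" "ball 0 r \<subseteq> U" using U_nhd by (meson mem_interior)
  define q where "q = (c2 / c1) powr (1 / k)"
  have q: "q > 0" using consts_pos by (simp add: q_def)
  define \<mu> where "\<mu> = r / (2 * q)"
  have \<mu>: "\<mu> > 0" "q * \<mu> < r" using r q by (auto simp: \<mu>_def)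
  have "x \<in> U \<times> Tset T2" if x: "x \<in> C" "V x \<le> c2 * \<mu> powr k" for x
  proof -
    have "norm (fst x) powr k \<le> c2 / c1 * \<mu> powr k"
      using V_lower[OF x(1)] x(2) consts_pos by (simp add: field_simps)
    then have "norm (fst x) \<le> q * \<mu>"
      unfolding q_def using consts_pos \<mu>(1) by (intro powr_le_mult_powrD) auto
    then have "fst x \<in> ball 0 r" using \<mu>(2) by simp
    then show ?thesis using r(2) x(1) by (cases x) (auto simp: Ccl_def)
  qed
  then show ?thesis using that[OF \<mu>(1)] by blast
qed

text \<open>Both claims are instances of one decay estimate: stability takes the sublevel set from
  \<open>small_sublevel\<close>, the basin takes the given one.\<close>

lemma exp_stable_and_basin:
  "exp_stable C f D G (Acl_set T2) \<and>
     (\<forall>c. {x \<in> C. V x \<le> c} \<subseteq> U \<times> Tset T2 \<longrightarrow> {x \<in> C. V x \<le> c} \<subseteq> basin C f D G (Acl_set T2))"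
proof -
  define R where "R = (\<Sum>i\<in>UNIV. 1 / T1 $ i)"
  define P where "P = (\<Sum>i\<in>UNIV. T2 $ i / T1 $ i)"
  define lam where "lam = c3 / (k * (1 + R))"
  define \<kappa> where "\<kappa> = (c2 / c1) powr (1 / k) * exp (lam * P)"
  have "0 \<le> R" unfolding R_def using T1_pos by (intro sum_nonneg) (auto simp: less_imp_le)
  then have lam: "lam > 0" using consts_pos by (simp add: lam_def)
  have \<kappa>: "\<kappa> > 0" using consts_pos by (simp add: \<kappa>_def)
  have init: "\<phi> (0, 0) \<in> C" if "is_solution C f D G E \<phi>" for E \<phi>
    using that closure_closed[OF closed_Ccl[of T2]] Dcl_subset_Ccl[of T2] unfolding is_solution_def by blast
  have bound: "infdist (\<phi> (t, j)) (Acl_set T2) \<le> \<kappa> * exp (- lam * (t + real j)) * infdist (\<phi> (0, 0)) (Acl_set T2)"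
    if "is_solution C f D G E \<phi>" "{x \<in> C. V x \<le> c} \<subseteq> U \<times> Tset T2" "V (\<phi> (0, 0)) \<le> c" "(t, j) \<in> E" for E \<phi> c t j
    using solution_norm_decay[OF that P_def R_def] solution_in_C[OF that] init[OF that(1)]
    by (simp add: infdist_Acl_set \<kappa>_def lam_def)
  show ?thesis
  proof (intro conjI allI impI)
    obtain \<mu> where \<mu>: "\<mu> > 0" "{x \<in> C. V x \<le> c2 * \<mu> powr k} \<subseteq> U \<times> Tset T2"
      using small_sublevel by blast
    have "complete_dom E \<and> (\<forall>t j. (t, j) \<in> E \<longrightarrow> infdist (\<phi> (t, j)) (Acl_set T2)
        \<le> \<kappa> * exp (- lam * (t + real j)) * infdist (\<phi> (0, 0)) (Acl_set T2))"
      if max: "maximal_solution C f D G E \<phi>" and small: "infdist (\<phi> (0, 0)) (Acl_set T2) \<le> \<mu>" for E \<phi>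
    proof -
      have sol: "is_solution C f D G E \<phi>" using max by (simp add: maximal_solution_def)
      have "V (\<phi> (0, 0)) \<le> c2 * norm (fst (\<phi> (0, 0))) powr k" by (rule V_upper[OF init[OF sol]])
      also have "\<dots> \<le> c2 * \<mu> powr k"
        using small infdist_Acl_set[OF init[OF sol]] consts_pos by (intro mult_left_mono powr_mono2) auto
      finally have V0: "V (\<phi> (0, 0)) \<le> c2 * \<mu> powr k" .
      show ?thesis using solution_complete[OF sol \<mu>(2) V0 max] bound[OF sol \<mu>(2) V0] by blast
    qed
    then show "exp_stable C f D G (Acl_set T2)"
      unfolding exp_stable_def using \<kappa> lam \<mu>(1) by blast
  next
    fix c assume sub: "{x \<in> C. V x \<le> c} \<subseteq> U \<times> Tset T2"
    have "complete_dom E \<and> (\<forall>e>0. \<exists>M. \<forall>t j. (t, j) \<in> E \<and> M \<le> t + real j \<longrightarrow> infdist (\<phi> (t, j)) (Acl_set T2) < e)"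
      if V0: "V (\<phi> (0, 0)) \<le> c" and max: "maximal_solution C f D G E \<phi>" for E \<phi>
    proof (intro conjI allI impI)
      have sol: "is_solution C f D G E \<phi>" using max by (simp add: maximal_solution_def)
      show "complete_dom E" by (rule solution_complete[OF sol sub V0 max])
      fix e :: real assume e: "e > 0"
      define d where "d = \<kappa> * infdist (\<phi> (0, 0)) (Acl_set T2)"
      have d: "0 \<le> d" unfolding d_def using \<kappa> by (intro mult_nonneg_nonneg infdist_nonneg) simp
      \<comment> \<open>Solves \<open>exp (- lam * M) = e / (d + 1)\<close>; the \<open>+ 1\<close>
        keeps the logarithm meaningful for \<open>d = 0\<close> and the final inequality
        strict.\<close>
      define M where "M = ln ((d + 1) / e) / lam"
      have "infdist (\<phi> (t, j)) (Acl_set T2) < e" if tj: "(t, j) \<in> E" "M \<le> t + real j" for t j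
      proof -
        have "infdist (\<phi> (t, j)) (Acl_set T2) \<le> d * exp (- lam * (t + real j))"
          using bound[OF sol sub V0 tj(1)] by (simp add: d_def ac_simps)
        also have "\<dots> \<le> d * exp (- lam * M)"
          using d lam tj(2) by (intro mult_left_mono) auto
        also have "exp (- lam * M) = e / (d + 1)"
          using lam d e by (simp add: M_def exp_minus)
        also have "d * (e / (d + 1)) < e" using d e by (simp add: field_simps)
        finally show ?thesis .
      qed
      then show "\<exists>M. \<forall>t j. (t, j) \<in> E \<and> M \<le> t + real j \<longrightarrow> infdist (\<phi> (t, j)) (Acl_set T2) < e" by blast
    qed
    then show "{x \<in> C. V x \<le> c} \<subseteq> basin C f D G (Acl_set T2)"
      unfolding basin_def by blast
  qed
qed

end

theorem theorem2:
  fixes blk :: "'n::{finite,linorder} \<Rightarrow> 'q::{finite,linorder}"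
    and A :: "((real, 'n) vec, 'n) vec" and B :: "((real, 'm::finite) vec, 'n) vec" and K :: "((real, 'n) vec, 'm) vec" and ub :: "(real, 'm) vec"
    and T1 T2 :: "(real, 'q) vec"
    and V :: "(((real, 'n) vec) \<times> ((real, 'n) vec)) \<times> ((real, 'q) vec) \<Rightarrow> real"
    and gradV :: "(((real, 'n) vec) \<times> ((real, 'n) vec)) \<times> ((real, 'q) vec) \<Rightarrow> (((real, 'n) vec) \<times> ((real, 'n) vec)) \<times> ((real, 'q) vec)"
    and k c1 c2 c3 :: real
    and U :: "(((real, 'n) vec) \<times> ((real, 'n) vec)) set"
  assumes blk_surj: "surj blk" and blk_mono: "mono blk"
    and ub_pos: "\<forall>i. ub $ i > 0"
    and T1_pos: "\<forall>i. 0 < T1 $ i" and T1_le_T2: "\<forall>i. T1 $ i \<le> T2 $ i"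
    and V_deriv: "\<forall>x. (V has_derivative (\<lambda>h. gradV x \<bullet> h)) (at x)"
    and gradV_cont: "continuous_on UNIV gradV"
    and consts_pos: "k > 0" "c1 > 0" "c2 > 0" "c3 > 0"
    and U_nhd: "0 \<in> interior U"
    and V_bounds: "\<forall>x\<in>Ccl T2. c1 * infdist x (Acl_set T2) powr k \<le> V x \<and>
                               V x \<le> c2 * infdist x (Acl_set T2) powr k"
    and V_flow: "\<forall>x\<in>U \<times> Tset T2. gradV x \<bullet> fcl A B K ub x \<le> - c3 * V x"
    and V_jump: "\<forall>x\<in>Dcl T2. \<forall>g\<in>Gcl blk T1 T2 x. V g - V x \<le> 0"
  shows "exp_stable (Ccl T2) (fcl A B K ub) (Dcl T2) (Gcl blk T1 T2) (Acl_set T2) \<and>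
         (\<forall>c. {x \<in> Ccl T2. V x \<le> c} \<subseteq> U \<times> Tset T2 \<longrightarrow>
              {x \<in> Ccl T2. V x \<le> c} \<subseteq> basin (Ccl T2) (fcl A B K ub) (Dcl T2) (Gcl blk T1 T2) (Acl_set T2))"
proof -
  interpret closed_loop_lyapunov blk A B K ub T1 T2 V gradV k c1 c2 c3 U
  proof
    show "c1 * norm (fst x) powr k \<le> V x" "V x \<le> c2 * norm (fst x) powr k" if "x \<in> Ccl T2" for x
      using V_bounds that infdist_Acl_set[OF that] by auto
  qed (use assms in auto)
  show ?thesis by (rule exp_stable_and_basin)
qed

end
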